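(* Let $(\widehat\theta,\widehat\eta)$ and $(\widehat\theta^{*},\widehat\eta^{*})$ be the semiparametric M-estimator and its exchangeably weighted bootstrap version, as defined in the context. Suppose that the bootstrap weights satisfy Conditions W1--W5 of the context, with constant $c>0$ as in W5, and that the following hold. (M1) There is a constant $K>0$ such that for all $(\theta,\eta)\in\Theta\times\mathcal H$, $$E_X\big(m(\theta,\eta)-m(\theta_0,\eta_0)\big)\le -K\big(\|\theta-\theta_0\|^2+d^2(\eta,\eta_0)\big).$$ (M2) For $\delta>0$ let $\mathcal N_\delta=\{m(\theta,\eta)-m(\theta_0,\eta_0): \|\theta-\theta_0\|\le\delta,\ d(\eta,\eta_0)\le\delta,\ (\theta,\eta)\in\Theta\times\mathcal H\}$. For some $p'\ge 1$ there is a universal constant $C$ such that for every $\delta>0$ (and every $n$), $$\big(E_X\|\mathbb G_n\|_{\mathcal N_\delta}^{p'}\big)^{1/p'}\le C\delta,\qquad \big(E_{XW}\|\mathbb G_n^{*}\|_{\mathcal N_\delta}^{p'}\big)^{1/p'}\le C\delta .$$ (M3) $d(\widehat\eta,\eta_0)=O_{P_X}(n^{-1/2})$ and $d(\widehat\eta^{*},\eta_0)=O_{P_{XW}}(n^{-1/2})$. Suppose moreover that $\widehat\theta^{*}$ is distribution consistent: conditionally on $\mathcal X_n=(X_1,\dots,X_n)$, $(\sqrt n/c)(\widehat\theta^{*}-\widehat\theta)$ converges weakly to $N(0,\Sigma)$ in $P_X$-probability. Then for any integer $p$ with $1\le p<p'$ and any continuous function $\rho_p:\mathbb R^d\to\mathbb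 R$ for which there are constants $K_1,K_2>0$ with $|\rho_p(x)|\le K_1+K_2\|x\|^p$ for all $x\in\mathbb R^d$, $$E_{W|\mathcal X_n}\,\rho_p\big((\sqrt n/c)(\widehat\theta^{*}-\widehat\theta)\big)\ \longrightarrow\ E\rho_p(T)\quad\text{in } P_X\text{-probability as } n\to\infty,$$ where $T\sim N(0,\Sigma)$.
   Context: Setting. $X_1,X_2,\dots$ are i.i.d. with law $P_X$; $\Theta\subset\mathbb R^d$ is the space of the Euclidean parameter $\theta$, and $\mathcal H$ is an infinite-dimensional parameter space (nuisance parameter $\eta$) with distance $d(\cdot,\cdot)$. For each $(\theta,\eta)\in\Theta\times\mathcal H$, $m(\theta,\eta)$ is a real-valued function of an observation $x$ (the objective function). Put $(\theta_0,\eta_0)=\arg\sup_{\theta\in\Theta,\eta\in\mathcal H}E_X m(\theta,\eta)(X)$. For each $n$, $W_n=(W_{n1},\dots,W_{nn})'$ is a random vector of bootstrap weights with law $P_W$, independent of the data. $E_{W|\mathcal X_n}$, $P_{W|\mathcal X_n}$ denote conditional expectation and probability given $\mathcal X_n=(X_1,\dots,X_n)$; $E_{XW}$, $P_{XW}$ denote joint expectation and probability. Write $P_Xf=\int f\,dP_X$, $\mathbb P_nf=n^{-1}\sum_{i=1}^n f(X_i)$, $\mathbb P_n^{*}f=n^{-1}\sum_{i=1}^n W_{ni}f(X_i)$, $\mathbb G_nf=\sqrt n(\mathbb P_n-P_X)f$, $\mathbb G_n^{*}f=\sqrt n(\mathbb P_n^{*}-\mathbb P_n)f$, and $\|\mathbb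 G_n\|_{\mathcal F}=\sup_{f\in\mathcal F}|\mathbb G_nf|$, $\|\mathbb G_n^{*}\|_{\mathcal F}=\sup_{f\in\mathcal F}|\mathbb G_n^{*}f|$ for a class of functions $\mathcal F$. Estimators: $(\widehat\theta,\widehat\eta)=\arg\sup_{\theta\in\Theta,\eta\in\mathcal H}\mathbb P_n m(\theta,\eta)$ and $(\widehat\theta^{*},\widehat\eta^{*})=\arg\sup_{\theta\in\Theta,\eta\in\mathcal H}\mathbb P_n^{*}m(\theta,\eta)$. $\Sigma$ is a fixed $d\times d$ covariance matrix. Weight conditions, where $\|Y\|_{2,1}=\int_0^\infty\sqrt{P_W(|Y|\ge u)}\,du$: W1. $W_n$ is exchangeable for every $n$. W2. $W_{ni}\ge0$ for all $n,i$ and $\sum_{i=1}^nW_{ni}=n$ for all $n$. W3. $\limsup_{n\to\infty}\|W_{n1}\|_{2,1}<\infty$. W4. $\lim_{\lambda\to\infty}\limsup_{n\to\infty}\sup_{t\ge\lambda}t^2P_W(W_{n1}>t)=0$. W5. $n^{-1}\sum_{i=1}^n(W_{ni}-1)^2\to c^2$ in $P_W$-probability, for a constant $c^2>0$. Conditional weak convergence: for a random vector $T_n^{*}$ that is a function of $(X_1,\dots,X_n)$ and $(W_{n1},\dots,W_{nn})$, the conditional distribution of $T_n^{*}$ given $\mathcal X_n$ converges weakly to a fixed distribution $\mu$ in $P_X$-probability if $\sup_{f\in BL_1}|E_{W|\mathcal X_n}f(T_n^{*})-\int f\,d\mu|\to0$ in $P_X$-probability, where $BL_1$ is the class of functions bounded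 by 1 in absolute value with Lipschitz constant at most 1. *)

theory Defs
  imports "HOL-Probability.Probability"
begin

text \<open>
  The suprema over function classes below need not be measurable, so probabilities and
  expectations of such quantities are outer ones; they agree with the ordinary ones in the
  measurable case.  (The library's nonnegative integral of a non-measurable function is an inner
  integral and would not be the right notion here.)
\<close>

definition outer_expectation :: "'a measure \<Rightarrow> ('a \<Rightarrow> ennreal) \<Rightarrow> ennreal" where
  "outer_expectation M Y =
     (INF Z \<in> {Z \<in> borel_measurable M. \<forall>\<omega>\<in>space M. Y \<omega> \<le> Z \<omega>}. \<integral>\<^sup>+\<omega>. Z \<omega> \<partial>M)"

definition ennreal_powr :: "ennreal \<Rightarrow> real \<Rightarrow> ennreal" where
  \<comment> \<open>intended for positive exponents\<close>
  "ennreal_powr x a = (if x = \<top> then \<top> else ennreal (enn2real x powr a))"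

definition outer_Lp_norm :: "'a measure \<Rightarrow> real \<Rightarrow> ('a \<Rightarrow> ennreal) \<Rightarrow> ennreal" where
  "outer_Lp_norm M p Y = ennreal_powr (outer_expectation M (\<lambda>\<omega>. ennreal_powr (Y \<omega>) p)) (1 / p)"

definition conv_in_prob :: "'a measure \<Rightarrow> (nat \<Rightarrow> 'a \<Rightarrow> real) \<Rightarrow> real \<Rightarrow> bool" where
  "conv_in_prob M Y l \<longleftrightarrow>
     (\<forall>\<epsilon>>0. (\<lambda>n. outer_measure_of M {\<omega>\<in>space M. \<bar>Y n \<omega> - l\<bar> > \<epsilon>}) \<longlonglongrightarrow> 0)"

definition bigO_in_prob :: "'a measure \<Rightarrow> (nat \<Rightarrow> 'a \<Rightarrow> real) \<Rightarrow> (nat \<Rightarrow> real) \<Rightarrow> bool" where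
  "bigO_in_prob M Y r \<longleftrightarrow>
     (\<forall>\<epsilon>>0. \<exists>B>0. \<forall>\<^sub>F n in sequentially.
        outer_measure_of M {\<omega>\<in>space M. \<bar>Y n \<omega>\<bar> > B * r n} \<le> ennreal \<epsilon>)"


text \<open>
  The first \<open>n\<close> members of a sequence of random variables (observations or weights), as an element
  of a finite product space.  Indices run over \<open>0, \<dots>, n - 1\<close>.
\<close>

definition sample :: "nat \<Rightarrow> (nat \<Rightarrow> 'a \<Rightarrow> 'x) \<Rightarrow> 'a \<Rightarrow> nat \<Rightarrow> 'x" where
  "sample n Y \<omega> = (\<lambda>i\<in>{..<n}. Y i \<omega>)"

definition emp_mean :: "nat \<Rightarrow> (nat \<Rightarrow> 'x) \<Rightarrow> ('x \<Rightarrow> real) \<Rightarrow> real" where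
  "emp_mean n x f = (\<Sum>i<n. f (x i)) / real n"

definition boot_mean :: "nat \<Rightarrow> (nat \<Rightarrow> real) \<Rightarrow> (nat \<Rightarrow> 'x) \<Rightarrow> ('x \<Rightarrow> real) \<Rightarrow> real" where
  "boot_mean n w x f = (\<Sum>i<n. w i * f (x i)) / real n"

definition emp_process :: "'x measure \<Rightarrow> nat \<Rightarrow> (nat \<Rightarrow> 'x) \<Rightarrow> ('x \<Rightarrow> real) \<Rightarrow> real" where
  "emp_process P n x f = sqrt (real n) * (emp_mean n x f - (\<integral>y. f y \<partial>P))"

definition boot_process :: "nat \<Rightarrow> (nat \<Rightarrow> real) \<Rightarrow> (nat \<Rightarrow> 'x) \<Rightarrow> ('x \<Rightarrow> real) \<Rightarrow> real" where
  "boot_process n w x f = sqrt (real n) * (boot_mean n w x f - emp_mean n x f)"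

definition sup_norm_on :: "('x \<Rightarrow> real) set \<Rightarrow> (('x \<Rightarrow> real) \<Rightarrow> real) \<Rightarrow> ennreal" where
  "sup_norm_on F G = (SUP f\<in>F. ennreal \<bar>G f\<bar>)"

definition nbhd_class ::
  "('t::real_normed_vector \<Rightarrow> 'h \<Rightarrow> 'x \<Rightarrow> real) \<Rightarrow> 't set \<Rightarrow> 'h set \<Rightarrow> ('h \<Rightarrow> 'h \<Rightarrow> real) \<Rightarrow>
     't \<Rightarrow> 'h \<Rightarrow> real \<Rightarrow> ('x \<Rightarrow> real) set" where
  "nbhd_class m \<Theta> H d \<theta>0 \<eta>0 \<delta> =
     {(\<lambda>x. m \<theta> \<eta> x - m \<theta>0 \<eta>0 x) | \<theta> \<eta>. \<theta> \<in> \<Theta> \<and> \<eta> \<in> H \<and> norm (\<theta> - \<theta>0) \<le> \<delta> \<and> d \<eta> \<eta>0 \<le> \<delta>}"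


definition exchangeable :: "'w measure \<Rightarrow> nat \<Rightarrow> (nat \<Rightarrow> 'w \<Rightarrow> real) \<Rightarrow> bool" where
  "exchangeable M n Y \<longleftrightarrow>
     (\<forall>\<pi>. \<pi> permutes {..<n} \<longrightarrow>
        distr M (Pi\<^sub>M {..<n} (\<lambda>_. borel)) (sample n (\<lambda>i. Y (\<pi> i))) =
        distr M (Pi\<^sub>M {..<n} (\<lambda>_. borel)) (sample n Y))"

definition norm_21 :: "'w measure \<Rightarrow> ('w \<Rightarrow> real) \<Rightarrow> ennreal" where
  "norm_21 M Y = (\<integral>\<^sup>+u\<in>{0..}. ennreal (sqrt (measure M {\<omega>\<in>space M. \<bar>Y \<omega>\<bar> \<ge> u})) \<partial>lborel)"

definition bootstrap_weights :: "'w measure \<Rightarrow> (nat \<Rightarrow> nat \<Rightarrow> 'w \<Rightarrow> real) \<Rightarrow> real \<Rightarrow> bool" where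
  "bootstrap_weights M W c \<longleftrightarrow>
     (\<forall>n. \<forall>i<n. W n i \<in> borel_measurable M) \<and>
     (\<forall>n. exchangeable M n (W n)) \<and>
     (\<forall>n. AE \<omega> in M. (\<forall>i<n. W n i \<omega> \<ge> 0) \<and> (\<Sum>i<n. W n i \<omega>) = real n) \<and>
     limsup (\<lambda>n. norm_21 M (W n 0)) < \<infinity> \<and>
     ((\<lambda>l. limsup (\<lambda>n. SUP t\<in>{l..}. ennreal (t\<^sup>2 * measure M {\<omega>\<in>space M. W n 0 \<omega> > t})))
        \<longlongrightarrow> 0) (at_top :: real filter) \<and>
     conv_in_prob M (\<lambda>n \<omega>. (\<Sum>i<n. (W n i \<omega> - 1)\<^sup>2) / real n) (c\<^sup>2)"


definition covariance_matrix :: "real^'d^'d \<Rightarrow> bool" where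
  "covariance_matrix S \<longleftrightarrow> transpose S = S \<and> (\<forall>x. x \<bullet> (S *v x) \<ge> 0)"

text \<open>
  The centred normal distribution with covariance matrix \<open>S\<close> (possibly singular): the law of
  \<open>A Z\<close> with \<open>A A\<^sup>T = S\<close> and \<open>Z\<close> a vector of independent standard normal variables.  For a
  covariance matrix such an \<open>A\<close> exists, and the law does not depend on which one is chosen.
\<close>

definition centred_normal :: "real^'d^'d \<Rightarrow> (real^'d) measure" where
  "centred_normal S =
     distr (Pi\<^sub>M (UNIV :: 'd set) (\<lambda>_. density lborel (\<lambda>x. ennreal (std_normal_density x)))) borel
       (\<lambda>z. (SOME A :: real^'d^'d. A ** transpose A = S) *v (\<chi> i. z i))"


text \<open>
  Data and weights live on the two factors of the product space \<open>MX \<Otimes>\<^sub>M MW\<close>, so they are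
  independent, and the conditional expectation of \<open>g\<close> given the data is \<open>\<omega> \<mapsto> \<integral>w. g (\<omega>, w) \<partial>MW\<close>
  whenever \<open>g\<close> depends on the first coordinate only through the data.
\<close>

definition bounded_Lipschitz_1 :: "('t::real_normed_vector \<Rightarrow> real) set" where
  "bounded_Lipschitz_1 = {f. (\<forall>x. \<bar>f x\<bar> \<le> 1) \<and> 1-lipschitz_on UNIV f}"

definition cond_weak_conv ::
  "'a measure \<Rightarrow> 'w measure \<Rightarrow> (nat \<Rightarrow> 'a \<Rightarrow> 'w \<Rightarrow> 't::real_normed_vector) \<Rightarrow> 't measure \<Rightarrow> bool" where
  "cond_weak_conv MX MW T \<mu> \<longleftrightarrow>
     conv_in_prob MX
       (\<lambda>n \<omega>. SUP f\<in>bounded_Lipschitz_1. \<bar>(\<integral>w. f (T n \<omega> w) \<partial>MW) - (\<integral>t. f t \<partial>\<mu>)\<bar>) 0"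

definition boot_root ::
  "real \<Rightarrow> (nat \<Rightarrow> nat \<Rightarrow> 'w \<Rightarrow> real) \<Rightarrow> (nat \<Rightarrow> 'a \<Rightarrow> 'x) \<Rightarrow>
     (nat \<Rightarrow> (nat \<Rightarrow> 'x) \<times> (nat \<Rightarrow> real) \<Rightarrow> 't) \<Rightarrow> (nat \<Rightarrow> (nat \<Rightarrow> 'x) \<Rightarrow> 't) \<Rightarrow>
     nat \<Rightarrow> 'a \<Rightarrow> 'w \<Rightarrow> 't::real_normed_vector" where
  "boot_root c W X \<theta>star \<theta>hat n \<omega> w =
     (sqrt (real n) / c) *\<^sub>R (\<theta>star n (sample n X \<omega>, sample n (W n) w) - \<theta>hat n (sample n X \<omega>))"

end

theory Submission
  imports Defs
begin

text \<open>
  The basic inequality of M-estimation, together with (M1), bounds the squared distance of the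
  (bootstrap) estimator from the truth by the empirical and bootstrap processes on a neighbourhood
  of that radius. Peeling over the dyadic shells \<open>2\<^sup>j\<^sup>-\<^sup>1 < \<surd>n r \<le> 2\<^sup>j\<close> and (M2) then yield, for
  \<open>p < q < p'\<close>, a bound on the \<open>q\<close>-th joint moment of the bootstrap root that is uniform in \<open>n\<close>.
  Hence the \<open>p\<close>-th conditional moments are uniformly integrable in probability: off a ball, the
  error of replacing \<open>\<rho>\<close> by a bounded Lipschitz function is controlled by Markov's inequality, and
  on bounded Lipschitz functions convergence is the assumed conditional weak convergence.
\<close>

text \<open>Neither the suprema over \<open>nbhd_class\<close> nor the distance of the nuisance
  estimator from \<open>\<eta>0\<close> comes with any measurability, so the shells cannot be
  integrated over one by one. Instead (M2) is turned into measurable majorants, one for each radius,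
  and the root is dominated pointwise by a weighted series of the majorants at the dyadic radii;
  only this series is integrated. The basic inequality is quadratic in the radius while the bound in
  (M2) is linear. Shell \<open>j\<close> therefore contributes a constant times the
  \<open>j\<close>-th power of \<open>2 powr (q - p')\<close>, which is summable because
  \<open>q < p'\<close>. The other gap, \<open>p < q\<close>, makes the truncation error at radius
  \<open>L\<close> decay like \<open>L powr (p - q)\<close>. The ordinary estimator needs no
  argument of its own: it is the bootstrap estimator with unit weights, for which the bootstrap
  process vanishes. For the limit law the moment of order \<open>p + 1\<close> takes the place of
  the one of order \<open>q\<close>.\<close>

section \<open>Powers of extended reals and measurable majorants\<close>

lemma ennreal_powr_mono: "0 \<le> a \<Longrightarrow> x \<le> y \<Longrightarrow> ennreal_powr x a \<le> ennreal_powr y a"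
  by (auto simp: ennreal_powr_def top_unique less_top intro!: ennreal_leI powr_mono2 enn2real_mono)

lemma ennreal_powr_ennreal: "0 \<le> x \<Longrightarrow> ennreal_powr (ennreal x) a = ennreal (x powr a)"
  by (simp add: ennreal_powr_def)

text \<open>Instead of showing that the infimum in \<open>outer_expectation\<close> is attained, the
  constant is enlarged from \<open>b\<close> to \<open>2 * b\<close>. As \<open>b > 0\<close> and
  \<open>p > 0\<close>, this leaves a strict gap, and some member of the family lies below it. Any
  factor above 1 would do; this one reappears as \<open>2 * C\<close> in the main theorem.\<close>

lemma outer_Lp_norm_majorant:
  assumes "outer_Lp_norm M p Y \<le> ennreal b" "p > 0" "b > 0"
  obtains Z where "Z \<in> borel_measurable M"
    "\<And>\<omega>. \<omega> \<in> space M \<Longrightarrow> ennreal_powr (Y \<omega>) p \<le> Z \<omega>"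
    "(\<integral>\<^sup>+\<omega>. Z \<omega> \<partial>M) \<le> ennreal ((2 * b) powr p)"
proof -
  define E where "E = outer_expectation M (\<lambda>\<omega>. ennreal_powr (Y \<omega>) p)"
  have le: "ennreal_powr E (1 / p) \<le> ennreal b"
    using assms(1) by (simp add: outer_Lp_norm_def E_def)
  then have fin: "E \<noteq> \<top>" and "enn2real E powr (1 / p) \<le> b"
    using \<open>b > 0\<close> by (auto simp: ennreal_powr_def top_unique split: if_splits)
  then have "(enn2real E powr (1 / p)) powr p \<le> b powr p"
    using \<open>p > 0\<close> by (intro powr_mono2) auto
  then have "enn2real E \<le> b powr p"
    using \<open>p > 0\<close> by (simp add: powr_powr split: if_splits)
  also have "\<dots> < (2 * b) powr p"
    using assms by (intro powr_less_mono2) auto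
  finally have "ennreal (enn2real E) < ennreal ((2 * b) powr p)"
    by (simp add: ennreal_less_iff)
  then have "E < ennreal ((2 * b) powr p)"
    using fin by (simp add: less_top)
  then show ?thesis
    unfolding E_def outer_expectation_def INF_less_iff by (auto intro: that less_imp_le)
qed

section \<open>Peeling and moment bounds for M-estimators\<close>

lemma dyadic_shell:
  fixes R :: real
  assumes "R > 1"
  obtains j :: nat where "2 ^ j / 2 < R" "R \<le> 2 ^ j"
proof -
  define j where "j = nat \<lceil>log 2 R\<rceil>"
  have pos: "log 2 R > 0"
    using assms by simp
  have j: "log 2 R \<le> real j" "real j - 1 < log 2 R"
    using pos unfolding j_def by linarith+
  have "R = 2 powr log 2 R"
    using assms by simp
  also have "\<dots> \<le> 2 powr real j"
    using j by simp
  finally have "R \<le> 2 ^ j"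
    by (simp add: powr_realpow)
  moreover have "2 powr (real j - 1) < 2 powr log 2 R"
    using j by simp
  then have "2 ^ j / 2 < R"
    using assms by (simp add: powr_diff powr_realpow)
  ultimately show ?thesis
    by (rule that[rotated])
qed

text \<open>\<open>R\<close> is the radius that is peeled, \<open>s\<close> the quantity whose
  moment is wanted. \<open>R\<close> is only asserted to exist at each point because in the
  application it contains the nuisance distance. The gain comes from comparing the quadratic lower
  bound \<open>\<kappa>\<close> times \<open>R\<close> squared with the linear growth
  \<open>D * t\<close> of the majorants.\<close>

lemma peeling_moment_bound:
  fixes s :: "'a \<Rightarrow> real" and Z :: "real \<Rightarrow> 'a \<Rightarrow> ennreal"
  assumes "prob_space M" and \<kappa>: "\<kappa> > 0" and D: "D > 0" and q: "0 \<le> q" "q < p"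
    and Z[measurable]: "\<And>t. t > 0 \<Longrightarrow> Z t \<in> borel_measurable M"
    and Z_le: "\<And>t. t > 0 \<Longrightarrow> (\<integral>\<^sup>+\<omega>. Z t \<omega> \<partial>M) \<le> ennreal ((D * t) powr p)"
    and shell: "AE \<omega> in M. 0 \<le> s \<omega> \<and>
      (\<exists>R\<ge>s \<omega>. \<forall>t>0. R \<le> t \<longrightarrow> ennreal ((\<kappa> * R\<^sup>2) powr p) \<le> Z t \<omega>)"
  shows "(\<integral>\<^sup>+\<omega>. ennreal (s \<omega> powr q) \<partial>M)
    \<le> ennreal (1 + (4 * D / \<kappa>) powr p / (1 - 2 powr (q - p)))"
proof -
  interpret prob_space M by fact
  \<comment> \<open>The weight turns the lower bound for \<open>Z (2 ^ j)\<close> on shell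
    \<open>j\<close> into the upper bound for \<open>s powr q\<close> there: the numerator uses the
    outer radius, the denominator the inner radius \<open>2 ^ j / 2\<close>.\<close>
  define a where "a j = (2 ^ j :: real) powr q / (\<kappa> * (2 ^ j / 2)\<^sup>2) powr p" for j :: nat
  have a_nonneg: "a j \<ge> 0" for j
    by (simp add: a_def)
  \<comment> \<open>The whole series is a bound at every point, whichever shell contains it, so no
    shell has to be a measurable set. The summand 1 covers the points with
    \<open>R \<le> 1\<close>.\<close>
  have pt: "AE \<omega> in M. ennreal (s \<omega> powr q) \<le> 1 + (\<Sum>j. ennreal (a j) * Z (2 ^ j) \<omega>)"
    using shell
  proof eventually_elim
    case (elim \<omega>)
    then obtain R where R: "0 \<le> s \<omega>" "s \<omega> \<le> R"
      "\<And>t. t > 0 \<Longrightarrow> R \<le> t \<Longrightarrow> ennreal ((\<kappa> * R\<^sup>2) powr p) \<le> Z t \<omega>"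
      by blast
    show ?case
    proof (cases "R \<le> 1")
      case True
      then have "s \<omega> powr q \<le> 1 powr q"
        using R q by (intro powr_mono2) auto
      then have "ennreal (s \<omega> powr q) \<le> 1"
        by simp
      then show ?thesis
        by (rule order_trans) (simp add: le_iff_add)
    next
      case False
      then obtain j where j: "2 ^ j / 2 < R" "R \<le> 2 ^ j"
        using dyadic_shell[of R] by auto
      have pos: "(\<kappa> * (2 ^ j / 2)\<^sup>2) powr p > 0"
        using \<kappa> by simp
      have "(\<kappa> * (2 ^ j / 2)\<^sup>2) powr p \<le> (\<kappa> * R\<^sup>2) powr p"
        using j \<kappa> q by (intro powr_mono2 mult_left_mono power_mono) auto
      then have Zj: "ennreal ((\<kappa> * (2 ^ j / 2)\<^sup>2) powr p) \<le> Z (2 ^ j) \<omega>"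
        using R(3)[of "2 ^ j"] j by (meson ennreal_leI order_trans zero_less_numeral zero_less_power)
      have "s \<omega> powr q \<le> (2 ^ j) powr q"
        using R j q by (intro powr_mono2) auto
      also have "\<dots> = a j * (\<kappa> * (2 ^ j / 2)\<^sup>2) powr p"
        using pos by (simp add: a_def)
      finally have "ennreal (s \<omega> powr q) \<le> ennreal (a j) * ennreal ((\<kappa> * (2 ^ j / 2)\<^sup>2) powr p)"
        by (simp add: ennreal_mult[symmetric] a_nonneg ennreal_leI)
      also have "\<dots> \<le> ennreal (a j) * Z (2 ^ j) \<omega>"
        using Zj by (rule mult_left_mono) simp
      also have "\<dots> \<le> (\<Sum>j. ennreal (a j) * Z (2 ^ j) \<omega>)"
        using sum_le_suminf[OF summableI, of "{j}" "\<lambda>j. ennreal (a j) * Z (2 ^ j) \<omega>"] by simp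
      finally show ?thesis
        by (rule order_trans) (simp add: le_iff_add add.commute)
    qed
  qed
  \<comment> \<open>The square of the radius in the denominator outweighs the single radius in the
    numerator, leaving a geometric sequence. The 4 comes from squaring the half in the inner
    radius.\<close>
  have a_eq: "a j * (D * 2 ^ j) powr p = (4 * D / \<kappa>) powr p * (2 powr (q - p)) ^ j" for j
  proof -
    have "(2::real) ^ j = 2 powr j"
      by (simp add: powr_realpow)
    moreover have "(\<kappa> * (2 ^ j / 2)\<^sup>2) = (\<kappa> / 4) * (2 ^ j * 2 ^ j)"
      by (simp add: power2_eq_square)
    ultimately show ?thesis
      using \<kappa> D unfolding a_def
      by (simp add: powr_mult powr_divide powr_powr powr_diff powr_add[symmetric]
          powr_realpow[symmetric] field_simps)
  qed
  have r: "2 powr (q - p) < (1::real)"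
    using q powr_less_mono[of "q - p" 0 2] by simp
  have "(\<integral>\<^sup>+\<omega>. ennreal (s \<omega> powr q) \<partial>M) \<le> (\<integral>\<^sup>+\<omega>. 1 + (\<Sum>j. ennreal (a j) * Z (2 ^ j) \<omega>) \<partial>M)"
    by (intro nn_integral_mono_AE pt)
  also have "\<dots> = 1 + (\<Sum>j. ennreal (a j) * (\<integral>\<^sup>+\<omega>. Z (2 ^ j) \<omega> \<partial>M))"
    by (simp add: nn_integral_add nn_integral_suminf nn_integral_cmult emeasure_space_1)
  also have "\<dots> \<le> 1 + (\<Sum>j. ennreal ((4 * D / \<kappa>) powr p * (2 powr (q - p)) ^ j))"
    unfolding a_eq[symmetric] using Z_le
    by (intro add_left_mono suminf_le) (auto simp: ennreal_mult a_nonneg intro!: mult_left_mono)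
  also have "(\<Sum>j. ennreal ((4 * D / \<kappa>) powr p * (2 powr (q - p)) ^ j)) =
      ennreal ((4 * D / \<kappa>) powr p / (1 - 2 powr (q - p)))"
  proof (rule suminf_ennreal_eq)
    show "(\<lambda>j. (4 * D / \<kappa>) powr p * (2 powr (q - p)) ^ j) sums ((4 * D / \<kappa>) powr p / (1 - 2 powr (q - p)))"
      using sums_mult[OF geometric_sums[of "2 powr (q - p)"], of "(4 * D / \<kappa>) powr p"] r by simp
  qed simp
  also have "1 + \<dots> = ennreal (1 + (4 * D / \<kappa>) powr p / (1 - 2 powr (q - p)))"
    using r by (subst ennreal_plus) auto
  finally show ?thesis .
qed

text \<open>By optimality \<open>f\<close> has nonnegative bootstrap mean, and by M1 its population
  mean is at most \<open>-K\<close> times the squared distance, so the difference of the two means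
  is at least \<open>K\<close> times the squared distance. Inserting the empirical mean splits this
  difference into the two processes. Of the factor \<open>n\<close>, one square root goes into the
  processes and the other stays in front.\<close>

lemma boot_argmax_basic_inequality:
  fixes \<theta>0 :: "'t::real_normed_vector" and d :: "'h \<Rightarrow> 'h \<Rightarrow> real"
  assumes "n > 0" and true_par: "\<theta>0 \<in> \<Theta>" "\<eta>0 \<in> H"
    and M1: "\<And>\<theta> \<eta>. \<theta> \<in> \<Theta> \<Longrightarrow> \<eta> \<in> H \<Longrightarrow>
      (\<integral>x. m \<theta> \<eta> x - m \<theta>0 \<eta>0 x \<partial>P) \<le> - K * ((norm (\<theta> - \<theta>0))\<^sup>2 + (d \<eta> \<eta>0)\<^sup>2)"
    and argmax: "is_arg_max (\<lambda>(\<theta>, \<eta>). boot_mean n w x (m \<theta> \<eta>)) (\<lambda>z. z \<in> \<Theta> \<times> H) (\<theta>, \<eta>)"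
  defines "f \<equiv> (\<lambda>x. m \<theta> \<eta> x - m \<theta>0 \<eta>0 x)"
  shows "K * (real n * ((norm (\<theta> - \<theta>0))\<^sup>2 + (d \<eta> \<eta>0)\<^sup>2)) \<le>
    sqrt (real n) * (boot_process n w x f + emp_process P n x f)"
proof -
  have in_par: "\<theta> \<in> \<Theta>" "\<eta> \<in> H"
    using argmax by (auto simp: is_arg_max_def)
  have "boot_mean n w x (m \<theta>0 \<eta>0) \<le> boot_mean n w x (m \<theta> \<eta>)"
    using argmax true_par by (force simp: is_arg_max_linorder)
  moreover have "boot_mean n w x f = boot_mean n w x (m \<theta> \<eta>) - boot_mean n w x (m \<theta>0 \<eta>0)"
    by (simp add: boot_mean_def f_def sum_subtractf right_diff_distrib diff_divide_distrib)
  ultimately have "0 \<le> boot_mean n w x f"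
    by simp
  then have "K * ((norm (\<theta> - \<theta>0))\<^sup>2 + (d \<eta> \<eta>0)\<^sup>2) \<le> boot_mean n w x f - (\<integral>x. f x \<partial>P)"
    using M1[OF in_par] unfolding f_def by simp
  then have "real n * (K * ((norm (\<theta> - \<theta>0))\<^sup>2 + (d \<eta> \<eta>0)\<^sup>2)) \<le>
      real n * (boot_mean n w x f - (\<integral>x. f x \<partial>P))"
    by (intro mult_left_mono) auto
  also have "\<dots> = (sqrt (real n) * sqrt (real n)) * (boot_mean n w x f - (\<integral>x. f x \<partial>P))"
    by simp
  also have "\<dots> = sqrt (real n) * (boot_process n w x f + emp_process P n x f)"
    unfolding boot_process_def emp_process_def by (simp add: algebra_simps)
  finally show ?thesis
    by (simp add: mult_ac)
qed

text \<open>Serves to bring a bound by one value of a process into the form of the hypothesis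
  \<open>shell\<close> of \<open>peeling_moment_bound\<close>, where only the majorant of the
  supremum is available.\<close>

lemma sup_norm_on_powr_majorant:
  assumes "f \<in> F" "ennreal_powr (sup_norm_on F G) p \<le> Z" "p \<ge> 0"
    and "0 \<le> k" "0 \<le> y" "y \<le> k * \<bar>G f\<bar>"
  shows "ennreal (y powr p) \<le> ennreal (k powr p) * Z"
proof -
  have "ennreal \<bar>G f\<bar> \<le> sup_norm_on F G"
    unfolding sup_norm_on_def using \<open>f \<in> F\<close> by (rule SUP_upper)
  then have "ennreal (\<bar>G f\<bar> powr p) \<le> ennreal_powr (sup_norm_on F G) p"
    using ennreal_powr_mono[OF \<open>p \<ge> 0\<close>] by (simp add: ennreal_powr_ennreal flip: ennreal_powr_ennreal)
  with assms(2) have "ennreal (\<bar>G f\<bar> powr p) \<le> Z"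
    by simp
  then have "ennreal (k powr p) * ennreal (\<bar>G f\<bar> powr p) \<le> ennreal (k powr p) * Z"
    by (rule mult_left_mono) simp
  moreover have "y powr p \<le> k powr p * \<bar>G f\<bar> powr p"
    using powr_mono2[of p y "k * \<bar>G f\<bar>"] assms by (simp add: powr_mult)
  then have "ennreal (y powr p) \<le> ennreal (k powr p) * ennreal (\<bar>G f\<bar> powr p)"
    by (simp add: ennreal_mult[symmetric] ennreal_leI)
  ultimately show ?thesis
    by (rule order_trans[rotated])
qed

text \<open>Peeling is applied to the scaled radius \<open>sqrt n * r\<close>, where
  \<open>r\<close> combines both distances. A scaled radius \<open>t\<close> corresponds to
  \<open>t / sqrt n\<close> in the maximal inequalities, and this factor cancels the
  \<open>sqrt n\<close> in front of the basic inequality, so the bound is free of \<open>n\<close>.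
  The lemma serves both estimators: \<open>M\<close> is the data space with unit weights in one case
  and the product space in the other.\<close>

lemma M_estimator_moment_bound:
  fixes \<theta>0 :: "'t::real_normed_vector" and d :: "'h \<Rightarrow> 'h \<Rightarrow> real"
    and x :: "'b \<Rightarrow> nat \<Rightarrow> 'x" and w :: "'b \<Rightarrow> nat \<Rightarrow> real"
  assumes "prob_space M" "n > 0" "K > 0" "C > 0" "0 \<le> q" "q < p" "1 \<le> p"
    and true_par: "\<theta>0 \<in> \<Theta>" "\<eta>0 \<in> H" and d_nonneg: "\<And>\<eta>. 0 \<le> d \<eta> \<eta>0"
    and M1: "\<And>\<theta> \<eta>. \<theta> \<in> \<Theta> \<Longrightarrow> \<eta> \<in> H \<Longrightarrow>
      (\<integral>x. m \<theta> \<eta> x - m \<theta>0 \<eta>0 x \<partial>P) \<le> - K * ((norm (\<theta> - \<theta>0))\<^sup>2 + (d \<eta> \<eta>0)\<^sup>2)"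
    and argmax: "AE \<omega> in M. is_arg_max (\<lambda>(\<theta>, \<eta>). boot_mean n (w \<omega>) (x \<omega>) (m \<theta> \<eta>))
      (\<lambda>z. z \<in> \<Theta> \<times> H) (\<phi> \<omega>, \<xi> \<omega>)"
    and U: "\<And>\<delta>. \<delta> > 0 \<Longrightarrow> \<exists>Z\<in>borel_measurable M. (\<integral>\<^sup>+\<omega>. Z \<omega> \<partial>M) \<le> ennreal ((C * \<delta>) powr p) \<and>
      (\<forall>\<omega>\<in>space M. ennreal_powr (sup_norm_on (nbhd_class m \<Theta> H d \<theta>0 \<eta>0 \<delta>)
        (emp_process P n (x \<omega>))) p \<le> Z \<omega>)"
    and V: "\<And>\<delta>. \<delta> > 0 \<Longrightarrow> \<exists>Z\<in>borel_measurable M. (\<integral>\<^sup>+\<omega>. Z \<omega> \<partial>M) \<le> ennreal ((C * \<delta>) powr p) \<and>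
      (\<forall>\<omega>\<in>space M. ennreal_powr (sup_norm_on (nbhd_class m \<Theta> H d \<theta>0 \<eta>0 \<delta>)
        (boot_process n (w \<omega>) (x \<omega>))) p \<le> Z \<omega>)"
  shows "(\<integral>\<^sup>+\<omega>. ennreal ((sqrt (real n) * norm (\<phi> \<omega> - \<theta>0)) powr q) \<partial>M)
    \<le> ennreal (1 + (16 * C / K) powr p / (1 - 2 powr (q - p)))"
proof -
  define \<N> where "\<N> = nbhd_class m \<Theta> H d \<theta>0 \<eta>0"
  define k where "k = sqrt (real n)"
  have k: "k > 0" "k * k = real n"
    using \<open>n > 0\<close> by (auto simp: k_def)
  \<comment> \<open>The peeling uses all dyadic radii at once, so the majorants are chosen as a
    family indexed by the radius.\<close>
  have "\<forall>\<delta>. \<exists>Z. \<delta> > 0 \<longrightarrow> Z \<in> borel_measurable M \<and>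
      (\<integral>\<^sup>+\<omega>. Z \<omega> \<partial>M) \<le> ennreal ((C * \<delta>) powr p) \<and>
      (\<forall>\<omega>\<in>space M. ennreal_powr (sup_norm_on (\<N> \<delta>) (emp_process P n (x \<omega>))) p \<le> Z \<omega>)"
    using U unfolding \<N>_def by blast
  then obtain ZU where ZU_meas: "\<And>\<delta>. \<delta> > 0 \<Longrightarrow> ZU \<delta> \<in> borel_measurable M"
    and ZU: "\<And>\<delta>. \<delta> > 0 \<Longrightarrow> (\<integral>\<^sup>+\<omega>. ZU \<delta> \<omega> \<partial>M) \<le> ennreal ((C * \<delta>) powr p)"
      "\<And>\<delta> \<omega>. \<delta> > 0 \<Longrightarrow> \<omega> \<in> space M \<Longrightarrow>
        ennreal_powr (sup_norm_on (\<N> \<delta>) (emp_process P n (x \<omega>))) p \<le> ZU \<delta> \<omega>"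
    unfolding choice_iff by blast
  have "\<forall>\<delta>. \<exists>Z. \<delta> > 0 \<longrightarrow> Z \<in> borel_measurable M \<and>
      (\<integral>\<^sup>+\<omega>. Z \<omega> \<partial>M) \<le> ennreal ((C * \<delta>) powr p) \<and>
      (\<forall>\<omega>\<in>space M. ennreal_powr (sup_norm_on (\<N> \<delta>) (boot_process n (w \<omega>) (x \<omega>))) p \<le> Z \<omega>)"
    using V unfolding \<N>_def by blast
  then obtain ZV where ZV_meas: "\<And>\<delta>. \<delta> > 0 \<Longrightarrow> ZV \<delta> \<in> borel_measurable M"
    and ZV: "\<And>\<delta>. \<delta> > 0 \<Longrightarrow> (\<integral>\<^sup>+\<omega>. ZV \<delta> \<omega> \<partial>M) \<le> ennreal ((C * \<delta>) powr p)"
      "\<And>\<delta> \<omega>. \<delta> > 0 \<Longrightarrow> \<omega> \<in> space M \<Longrightarrow>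
        ennreal_powr (sup_norm_on (\<N> \<delta>) (boot_process n (w \<omega>) (x \<omega>))) p \<le> ZV \<delta> \<omega>"
    unfolding choice_iff by blast
  \<comment> \<open>The sum is taken because either process may be the large one;
    \<open>k powr p\<close> accounts for the \<open>sqrt n\<close> in front of the basic
    inequality.\<close>
  define Z where "Z = (\<lambda>t \<omega>. ennreal (k powr p) * (ZU (t / k) \<omega> + ZV (t / k) \<omega>))"
  have "(\<integral>\<^sup>+\<omega>. ennreal ((k * norm (\<phi> \<omega> - \<theta>0)) powr q) \<partial>M)
    \<le> ennreal (1 + (4 * (2 * C) / (K / 2)) powr p / (1 - 2 powr (q - p)))"
  proof (rule peeling_moment_bound[where Z = Z])
    show "Z t \<in> borel_measurable M" if "t > 0" for t
      using that k ZU_meas[of "t / k"] ZV_meas[of "t / k"] unfolding Z_def by simp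
    show "(\<integral>\<^sup>+\<omega>. Z t \<omega> \<partial>M) \<le> ennreal ((2 * C * t) powr p)" if "t > 0" for t
    proof -
      have tk: "t / k > 0"
        using that k by simp
      have "(\<integral>\<^sup>+\<omega>. Z t \<omega> \<partial>M) =
          ennreal (k powr p) * ((\<integral>\<^sup>+\<omega>. ZU (t / k) \<omega> \<partial>M) + (\<integral>\<^sup>+\<omega>. ZV (t / k) \<omega> \<partial>M))"
        unfolding Z_def using ZU_meas[OF tk] ZV_meas[OF tk]
        by (simp add: nn_integral_cmult nn_integral_add)
      also have "\<dots> \<le> ennreal (k powr p) * (ennreal ((C * (t / k)) powr p) + ennreal ((C * (t / k)) powr p))"
        using ZU(1)[OF tk] ZV(1)[OF tk] by (intro mult_left_mono add_mono) auto
      also have "\<dots> = ennreal (2 * (C * t) powr p)"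
        using k that \<open>C > 0\<close>
        by (simp add: ennreal_mult[symmetric] ennreal_plus[symmetric] powr_mult powr_divide
            del: ennreal_plus)
      \<comment> \<open>Here \<open>1 \<le> p\<close> absorbs the 2 that stems from the two
        processes, so that \<open>D\<close> is \<open>2 * C\<close>.\<close>
      also have "2 * (C * t) powr p \<le> 2 powr p * (C * t) powr p"
        using powr_mono[of 1 p "2::real"] \<open>1 \<le> p\<close> by (intro mult_right_mono) auto
      also have "\<dots> = (2 * C * t) powr p"
        using \<open>C > 0\<close> that by (simp add: powr_mult)
      finally show ?thesis
        by (simp add: ennreal_leI)
    qed
    show "AE \<omega> in M. 0 \<le> k * norm (\<phi> \<omega> - \<theta>0) \<and> (\<exists>R\<ge>k * norm (\<phi> \<omega> - \<theta>0).
        \<forall>t>0. R \<le> t \<longrightarrow> ennreal ((K / 2 * R\<^sup>2) powr p) \<le> Z t \<omega>)"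
      using argmax AE_space
    proof eventually_elim
      case (elim \<omega>)
      define a b where "a = norm (\<phi> \<omega> - \<theta>0)" and "b = d (\<xi> \<omega>) \<eta>0"
      define r where "r = sqrt (a\<^sup>2 + b\<^sup>2)"
      define f where "f = (\<lambda>x. m (\<phi> \<omega>) (\<xi> \<omega>) x - m \<theta>0 \<eta>0 x)"
      have ab: "0 \<le> a" "0 \<le> b" "a \<le> r" "b \<le> r"
        using d_nonneg by (auto simp: a_def b_def r_def)
      have "K * (real n * (a\<^sup>2 + b\<^sup>2)) \<le> k * (boot_process n (w \<omega>) (x \<omega>) f + emp_process P n (x \<omega>) f)"
        unfolding a_def b_def k_def f_def
        by (rule boot_argmax_basic_inequality[where \<Theta> = \<Theta> and H = H and m = m])
          (fact \<open>n > 0\<close> true_par M1 elim(1))+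
      also have "a\<^sup>2 + b\<^sup>2 = r\<^sup>2"
        by (simp add: r_def)
      also have "real n * r\<^sup>2 = (k * r)\<^sup>2"
        using k by (simp add: power2_eq_square mult_ac)
      also have "k * (boot_process n (w \<omega>) (x \<omega>) f + emp_process P n (x \<omega>) f) \<le>
          k * \<bar>boot_process n (w \<omega>) (x \<omega>) f\<bar> + k * \<bar>emp_process P n (x \<omega>) f\<bar>"
        unfolding distrib_left using k by (intro add_mono mult_left_mono) auto
      \<comment> \<open>One of the two terms is at least half of the left side. Hence
        \<open>\<kappa>\<close> is \<open>K / 2\<close>, and \<open>4 * D / \<kappa>\<close> becomes
        \<open>16 * C / K\<close>.\<close>
      finally have cases: "K / 2 * (k * r)\<^sup>2 \<le> k * \<bar>boot_process n (w \<omega>) (x \<omega>) f\<bar> \<or>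
          K / 2 * (k * r)\<^sup>2 \<le> k * \<bar>emp_process P n (x \<omega>) f\<bar>"
        by linarith
      have "ennreal ((K / 2 * (k * r)\<^sup>2) powr p) \<le> Z t \<omega>" if t: "t > 0" "k * r \<le> t" for t
      proof -
        have tk: "t / k > 0" "r \<le> t / k"
          using t k by (auto simp: field_simps)
        have f: "f \<in> \<N> (t / k)"
          using elim(1) ab tk unfolding \<N>_def nbhd_class_def f_def a_def b_def
          by (fastforce simp: is_arg_max_def)
        have nonneg: "0 \<le> p" "0 \<le> k" "0 \<le> K / 2 * (k * r)\<^sup>2"
          using \<open>1 \<le> p\<close> k \<open>K > 0\<close> by auto
        from cases show ?thesis
        proof
          assume "K / 2 * (k * r)\<^sup>2 \<le> k * \<bar>boot_process n (w \<omega>) (x \<omega>) f\<bar>"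
          from sup_norm_on_powr_majorant[OF f ZV(2)[OF tk(1) elim(2)] nonneg this]
          show ?thesis
            by (rule order_trans) (auto simp: Z_def intro!: mult_left_mono)
        next
          assume "K / 2 * (k * r)\<^sup>2 \<le> k * \<bar>emp_process P n (x \<omega>) f\<bar>"
          from sup_norm_on_powr_majorant[OF f ZU(2)[OF tk(1) elim(2)] nonneg this]
          show ?thesis
            by (rule order_trans) (auto simp: Z_def intro!: mult_left_mono)
        qed
      qed
      moreover have "k * a \<le> k * r" "0 \<le> k * a"
        using ab k by auto
      ultimately show ?case
        unfolding a_def by blast
    qed
  qed (use assms in auto)
  also have "4 * (2 * C) / (K / 2) = 16 * C / K"
    by simp
  finally show ?thesis
    by (simp add: k_def)
qed

section \<open>Outer measure and Lipschitz approximation\<close>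

text \<open>Deviation events in \<open>conv_in_prob\<close> need not be measurable; subadditivity
  passes through measurable covers of equal measure.\<close>

lemma outer_measure_of_Un_le:
  "outer_measure_of M (A \<union> B) \<le> outer_measure_of M A + outer_measure_of M B"
proof (cases "A \<subseteq> space M \<and> B \<subseteq> space M")
  case True
  then obtain E F where E: "E \<in> sets M" "A \<subseteq> E" "outer_measure_of M A = emeasure M E"
    and F: "F \<in> sets M" "B \<subseteq> F" "outer_measure_of M B = emeasure M F"
    using outer_measure_of_attain[of A M] outer_measure_of_attain[of B M] by blast
  have "outer_measure_of M (A \<union> B) \<le> outer_measure_of M (E \<union> F)"
    using E F by (intro outer_measure_of_mono) auto
  also have "\<dots> \<le> outer_measure_of M A + outer_measure_of M B"
    using E F by (simp add: emeasure_subadditive)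
  finally show ?thesis .
next
  case False
  \<comment> \<open>A set that leaves the space has no measurable cover, and the infimum over the
    empty family is infinite, so the right side is infinite.\<close>
  have top: "outer_measure_of M S = \<top>" if "\<not> S \<subseteq> space M" for S
  proof -
    have empty: "{E \<in> sets M. S \<subseteq> E} = {}"
      using that sets.sets_into_space by blast
    show ?thesis
      unfolding outer_measure_of_def empty by simp
  qed
  show ?thesis
    using False top[of A] top[of B] by (elim de_Morgan_conj[THEN iffD1, THEN disjE]) simp_all
qed

text \<open>The approximant is the Lipschitz regularisation \<open>g x = INF y. f y + L * dist x y\<close>.\<close>
lemma bounded_uniformly_continuous_Lipschitz_approx:
  fixes f :: "'t::real_normed_vector \<Rightarrow> real"
  assumes uc: "uniformly_continuous_on UNIV f" and bound: "\<And>x. \<bar>f x\<bar> \<le> B" and "\<epsilon> > 0"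
  obtains L g where "L-lipschitz_on UNIV g" "\<And>x. \<bar>g x\<bar> \<le> B" "\<And>x. \<bar>f x - g x\<bar> \<le> \<epsilon>"
proof -
  have "B \<ge> 0"
    using bound[of 0] by linarith
  obtain \<delta> where \<delta>: "\<delta> > 0" "\<And>x y. dist y x < \<delta> \<Longrightarrow> dist (f y) (f x) < \<epsilon>"
    using uniformly_continuous_onE[OF uc \<open>\<epsilon> > 0\<close>] by (metis UNIV_I)
  \<comment> \<open>With this slope the penalty at distance at least \<open>\<delta>\<close> is at
    least \<open>2 * B\<close>, the largest possible oscillation of \<open>f\<close>. Nearer points
    are handled by uniform continuity.\<close>
  define L where "L = 2 * B / \<delta>"
  have "L \<ge> 0"
    using \<open>B \<ge> 0\<close> \<delta> by (simp add: L_def)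
  define g where "g x = (INF y. f y + L * dist x y)" for x
  have lower: "- B \<le> f y + L * dist x y" for x y
    using bound[of y] \<open>L \<ge> 0\<close> mult_nonneg_nonneg[of L "dist x y"] by (smt (verit) zero_le_dist)
  have bdd: "bdd_below (range (\<lambda>y. f y + L * dist x y))" for x
    using lower by (intro bdd_belowI2[where m = "- B"]) auto
  have g_le: "g x \<le> f y + L * dist x y" for x y
    unfolding g_def by (rule cINF_lower[OF bdd]) simp
  have g_le_f: "g x \<le> f x" for x
    using g_le[of x x] by simp
  have g_ge: "f x - \<epsilon> \<le> g x" for x
    unfolding g_def
  proof (rule cINF_greatest)
    fix y
    show "f x - \<epsilon> \<le> f y + L * dist x y"
    proof (cases "dist x y < \<delta>")
      case True
      then have "\<bar>f x - f y\<bar> < \<epsilon>"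
        using \<delta>(2)[of x y] by (simp add: dist_real_def)
      then show ?thesis
        using mult_nonneg_nonneg[OF \<open>L \<ge> 0\<close> zero_le_dist[of x y]] by linarith
    next
      case False
      then have "L * \<delta> \<le> L * dist x y"
        using \<open>L \<ge> 0\<close> by (intro mult_left_mono) auto
      moreover have "L * \<delta> = 2 * B"
        using \<delta> by (simp add: L_def)
      ultimately show ?thesis
        using bound[of x] bound[of y] \<open>\<epsilon> > 0\<close> by linarith
    qed
  qed simp
  have lip: "g x - g y \<le> L * dist x y" for x y
  proof -
    have "g x - L * dist x y \<le> g y"
      unfolding g_def[of y]
    proof (rule cINF_greatest)
      fix z
      have "L * dist x z \<le> L * (dist x y + dist y z)"
        using \<open>L \<ge> 0\<close> by (intro mult_left_mono dist_triangle)
      then show "g x - L * dist x y \<le> f z + L * dist y z"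
        using g_le[of x z] by (simp add: distrib_left)
    qed simp
    then show ?thesis
      by simp
  qed
  have "dist (g x) (g y) \<le> L * dist x y" for x y
    using lip[of x y] lip[of y x] by (simp add: dist_real_def dist_commute abs_le_iff)
  then have "L-lipschitz_on UNIV g"
    using \<open>L \<ge> 0\<close> by (intro lipschitz_onI) auto
  moreover have "\<bar>g x\<bar> \<le> B" for x
  proof -
    have "- B \<le> g x"
      unfolding g_def using lower by (intro cINF_greatest) auto
    then show ?thesis
      using g_le_f[of x] bound[of x] by linarith
  qed
  moreover have "\<bar>f x - g x\<bar> \<le> \<epsilon>" for x
    using g_le_f[of x] g_ge[of x] by linarith
  ultimately show ?thesis
    by (rule that)
qed

text \<open>Composing with the (nonexpansive) projection onto the ball makes \<open>\<rho>\<close> bounded and uniformly continuous.\<close>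
lemma continuous_Lipschitz_approx_on_ball:
  fixes \<rho> :: "'t::euclidean_space \<Rightarrow> real"
  assumes cont: "continuous_on UNIV \<rho>" and "L \<ge> 0" "\<epsilon> > 0"
    and growth: "\<And>x. \<bar>\<rho> x\<bar> \<le> K1 + K2 * norm x ^ p" and "K2 \<ge> 0"
  obtains N g where "N-lipschitz_on UNIV g" "bounded (range g)"
    "\<And>x. norm x \<le> L \<Longrightarrow> \<bar>\<rho> x - g x\<bar> \<le> \<epsilon>"
    "\<And>x. norm x > L \<Longrightarrow> \<bar>\<rho> x - g x\<bar> \<le> \<epsilon> + 2 * (K1 + K2 * norm x ^ p)"
proof -
  define \<pi> where "\<pi> = closest_point (cball (0::'t) L)"
  have ne: "cball (0::'t) L \<noteq> {}"
    using \<open>L \<ge> 0\<close> by simp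
  have \<pi>_in: "norm (\<pi> x) \<le> L" for x
    using closest_point_in_set[OF closed_cball ne, of x] by (simp add: \<pi>_def)
  have \<pi>_self: "\<pi> x = x" if "norm x \<le> L" for x
    using that by (simp add: \<pi>_def closest_point_self)
  have \<rho>_bound: "\<bar>\<rho> (\<pi> x)\<bar> \<le> K1 + K2 * L ^ p" for x
    by (rule order_trans[OF growth]) (use \<pi>_in \<open>K2 \<ge> 0\<close> in \<open>auto intro!: mult_left_mono power_mono\<close>)
  have uc: "uniformly_continuous_on (cball 0 L) \<rho>"
    using cont by (intro compact_uniformly_continuous) (auto intro: continuous_on_subset)
  have "uniformly_continuous_on UNIV (\<lambda>x. \<rho> (\<pi> x))"
    unfolding uniformly_continuous_on_def
  proof (intro allI impI)
    fix e :: real assume "e > 0"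
    then obtain \<delta> where \<delta>: "\<delta> > 0"
      "\<And>x y. norm x \<le> L \<Longrightarrow> norm y \<le> L \<Longrightarrow> dist y x < \<delta> \<Longrightarrow> dist (\<rho> y) (\<rho> x) < e"
      using uc unfolding uniformly_continuous_on_def by (metis mem_cball_0)
    have "dist (\<rho> (\<pi> y)) (\<rho> (\<pi> x)) < e" if "dist y x < \<delta>" for x y
      using that closest_point_lipschitz[OF convex_cball closed_cball ne, of y x]
      by (intro \<delta> \<pi>_in) (auto simp: \<pi>_def)
    with \<open>\<delta> > 0\<close> show "\<exists>\<delta>>0. \<forall>x\<in>UNIV. \<forall>y\<in>UNIV. dist y x < \<delta> \<longrightarrow> dist (\<rho> (\<pi> y)) (\<rho> (\<pi> x)) < e"
      by blast
  qed
  from bounded_uniformly_continuous_Lipschitz_approx[OF this \<rho>_bound \<open>\<epsilon> > 0\<close>]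
  obtain N g where g: "N-lipschitz_on UNIV g" "\<And>x. \<bar>g x\<bar> \<le> K1 + K2 * L ^ p"
    "\<And>x. \<bar>\<rho> (\<pi> x) - g x\<bar> \<le> \<epsilon>"
    by blast
  show ?thesis
  proof
    show "N-lipschitz_on UNIV g"
      by fact
    show "bounded (range g)"
      using g(2) by (auto simp: bounded_iff)
    show "\<bar>\<rho> x - g x\<bar> \<le> \<epsilon>" if "norm x \<le> L" for x
      using g(3)[of x] \<pi>_self[OF that] by simp
    show "\<bar>\<rho> x - g x\<bar> \<le> \<epsilon> + 2 * (K1 + K2 * norm x ^ p)" if "norm x > L" for x
    proof -
      \<comment> \<open>Outside the ball the growth bound at \<open>x\<close> also controls
        \<open>\<rho> (\<pi> x)\<close>, which explains the factor 2 in the claim.\<close>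
      have "L ^ p \<le> norm x ^ p"
        using that \<open>L \<ge> 0\<close> by (intro power_mono) auto
      then have "K2 * L ^ p \<le> K2 * norm x ^ p"
        using \<open>K2 \<ge> 0\<close> by (rule mult_left_mono)
      moreover have "\<bar>\<rho> x - g x\<bar> \<le> \<bar>\<rho> x\<bar> + \<bar>\<rho> (\<pi> x)\<bar> + \<bar>\<rho> (\<pi> x) - g x\<bar>"
        by linarith
      ultimately show ?thesis
        using g(3)[of x] \<rho>_bound[of x] growth[of x] by (simp add: distrib_left)
    qed
  qed
qed

section \<open>Moments of the limiting normal law\<close>

text \<open>The norm of \<open>v\<close> is at most the dimension times its largest coordinate in
  absolute value, and the \<open>k\<close>-th power of that coordinate is one of the summands. This
  reduces moments of a linear image to moments of single coordinates.\<close>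

lemma norm_matrix_vector_power_le:
  fixes A :: "real^'d^'d"
  obtains B where "B \<ge> 0" "\<And>v. norm (A *v v) ^ k \<le> B * (\<Sum>i\<in>UNIV. \<bar>v $ i\<bar> ^ k)"
proof -
  obtain b where b: "b > 0" "\<And>v. norm (A *v v) \<le> norm v * b"
    using bounded_linear.pos_bounded[OF matrix_vector_mul_bounded_linear[of A]] by blast
  show ?thesis
  proof
    show "0 \<le> (real CARD('d) * b) ^ k"
      using b by simp
    fix v :: "real^'d"
    obtain j where j: "\<And>i. \<bar>v $ i\<bar> \<le> \<bar>v $ j\<bar>"
      using Max_in[of "range (\<lambda>i. \<bar>v $ i\<bar>)"] Max_ge[of "range (\<lambda>i. \<bar>v $ i\<bar>)"] by fastforce
    have "norm v \<le> (\<Sum>i\<in>UNIV. \<bar>v $ i\<bar>)"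
      by (rule norm_le_l1_cart)
    also have "\<dots> \<le> real CARD('d) * \<bar>v $ j\<bar>"
      using sum_bounded_above[of UNIV "\<lambda>i. \<bar>v $ i\<bar>" "\<bar>v $ j\<bar>"] j by simp
    finally have "norm v * b \<le> real CARD('d) * \<bar>v $ j\<bar> * b"
      using b by simp
    with b(2)[of v] have "norm (A *v v) \<le> (real CARD('d) * b) * \<bar>v $ j\<bar>"
      by (simp add: mult_ac)
    then have "norm (A *v v) ^ k \<le> ((real CARD('d) * b) * \<bar>v $ j\<bar>) ^ k"
      by (intro power_mono) auto
    also have "\<dots> = (real CARD('d) * b) ^ k * \<bar>v $ j\<bar> ^ k"
      by (rule power_mult_distrib)
    also have "\<dots> \<le> (real CARD('d) * b) ^ k * (\<Sum>i\<in>UNIV. \<bar>v $ i\<bar> ^ k)"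
      using b by (intro mult_left_mono member_le_sum) auto
    finally show "norm (A *v v) ^ k \<le> (real CARD('d) * b) ^ k * (\<Sum>i\<in>UNIV. \<bar>v $ i\<bar> ^ k)" .
  qed
qed

text \<open>A linear image of independent standard normals inherits all moments from its
  coordinates: each coordinate has the standard normal law, whose absolute moments are
  finite.\<close>

lemma centred_normal_moments:
  fixes S :: "real^'d^'d"
  shows "prob_space (centred_normal S)" "sets (centred_normal S) = sets borel"
    "integrable (centred_normal S) (\<lambda>x. norm x ^ k)"
proof -
  define \<gamma> where "\<gamma> = density lborel (\<lambda>x. ennreal (std_normal_density x))"
  define A where "A = (SOME A :: real^'d^'d. A ** transpose A = S)"
  define N where "N = Pi\<^sub>M (UNIV :: 'd set) (\<lambda>_. \<gamma>)"
  have [measurable_cong]: "sets \<gamma> = sets borel"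
    by (simp add: \<gamma>_def)
  interpret \<gamma>: prob_space \<gamma>
    unfolding \<gamma>_def by (rule prob_space_normal_density) simp
  interpret N: prob_space N
    unfolding N_def by (intro prob_space_PiM \<gamma>.prob_space_axioms)
  have vec[measurable]: "(\<lambda>z. \<chi> i. z i) \<in> N \<rightarrow>\<^sub>M (borel :: (real^'d) measure)"
    unfolding N_def
    by (rule borel_measurable_euclidean_space[THEN iffD2]) (auto simp: Basis_vec_def inner_axis)
  have "(\<lambda>v. A *v v) \<in> borel_measurable borel"
    by (intro borel_measurable_continuous_onI linear_continuous_on matrix_vector_mul_bounded_linear)
  from measurable_compose[OF vec this]
  have [measurable]: "(\<lambda>z. A *v (\<chi> i. z i)) \<in> N \<rightarrow>\<^sub>M borel" .
  have eq: "centred_normal S = distr N borel (\<lambda>z. A *v (\<chi> i. z i))"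
    by (simp add: centred_normal_def N_def A_def \<gamma>_def)
  show "prob_space (centred_normal S)" "sets (centred_normal S) = sets borel"
    unfolding eq by (auto intro!: N.prob_space_distr)
  obtain B where B: "B \<ge> 0" "\<And>v. norm (A *v v) ^ k \<le> B * (\<Sum>i\<in>UNIV. \<bar>v $ i\<bar> ^ k)"
    using norm_matrix_vector_power_le[of A k] by blast
  have \<gamma>_int: "integrable \<gamma> (\<lambda>x. \<bar>x\<bar> ^ k)"
    unfolding \<gamma>_def using integrable_std_normal_moment_abs[of k]
    by (subst integrable_density) auto
  have "distr N \<gamma> (\<lambda>z. z i) = \<gamma>" for i
    unfolding N_def by (rule distr_PiM_component) (auto intro: \<gamma>.prob_space_axioms)
  then have "integrable N (\<lambda>z. \<bar>z i\<bar> ^ k)" for i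
    using integrable_distr[of "\<lambda>z. z i" N \<gamma> "\<lambda>x. \<bar>x\<bar> ^ k"] \<gamma>_int by (simp add: N_def)
  then have "integrable N (\<lambda>z. B * (\<Sum>i\<in>UNIV. \<bar>z i\<bar> ^ k))"
    by auto
  then have "integrable N (\<lambda>z. norm (A *v (\<chi> i. z i)) ^ k)"
    by (rule Bochner_Integration.integrable_bound) (use B(2)[of "\<chi> i. _ i"] B(1) in \<open>auto simp: sum_nonneg\<close>)
  then show "integrable (centred_normal S) (\<lambda>x. norm x ^ k)"
    unfolding eq using integrable_distr_eq[of "\<lambda>z. A *v (\<chi> i. z i)" N borel "\<lambda>x. norm x ^ k"] by simp
qed

section \<open>Truncation and convergence of conditional expectations\<close>

text \<open>Beyond radius \<open>L\<close> the \<open>p\<close>-th power is the \<open>q\<close>-th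
  power times \<open>norm x powr (p - q)\<close>, and that factor is at most
  \<open>L powr (p - q)\<close>. As \<open>L \<ge> 1\<close>, the constant \<open>K1\<close> can be
  absorbed into the same term. The lemma is stated for a random element \<open>t\<close> so that it
  applies to the conditional law of the root and, with the identity, to the limit law.\<close>

lemma truncation_error:
  fixes t :: "'b \<Rightarrow> 't::euclidean_space" and \<rho> g :: "'t \<Rightarrow> real"
  assumes "prob_space M" and t[measurable]: "t \<in> borel_measurable M"
    and \<rho>[measurable]: "\<rho> \<in> borel_measurable borel" and g[measurable]: "g \<in> borel_measurable borel"
    and "K1 \<ge> 0" "K2 \<ge> 0" and growth: "\<And>x. \<bar>\<rho> x\<bar> \<le> K1 + K2 * norm x ^ p"
    and g_bound: "bounded (range g)" and "L \<ge> 1" "\<epsilon> \<ge> 0"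
    and inside: "\<And>x. norm x \<le> L \<Longrightarrow> \<bar>\<rho> x - g x\<bar> \<le> \<epsilon>"
    and outside: "\<And>x. norm x > L \<Longrightarrow> \<bar>\<rho> x - g x\<bar> \<le> \<epsilon> + 2 * (K1 + K2 * norm x ^ p)"
    and "real p \<le> q" and moment: "integrable M (\<lambda>\<omega>. norm (t \<omega>) powr q)"
  shows "integrable M (\<lambda>\<omega>. \<rho> (t \<omega>))"
    and "\<bar>(\<integral>\<omega>. \<rho> (t \<omega>) \<partial>M) - (\<integral>\<omega>. g (t \<omega>) \<partial>M)\<bar>
      \<le> \<epsilon> + 2 * (K1 + K2) * L powr (real p - q) * (\<integral>\<omega>. norm (t \<omega>) powr q \<partial>M)"
proof -
  interpret prob_space M by fact
  have power_le: "norm x ^ p \<le> 1 + norm x powr q" for x :: 't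
  proof (cases "norm x \<le> 1")
    case True
    then have "norm x ^ p \<le> 1"
      by (simp add: power_le_one)
    then show ?thesis
      by (simp add: add_increasing2)
  next
    case False
    then have "norm x ^ p = norm x powr real p"
      by (intro powr_realpow[symmetric]) linarith
    also have "\<dots> \<le> norm x powr q"
      using False \<open>real p \<le> q\<close> by (intro powr_mono) auto
    finally show ?thesis
      by simp
  qed
  show int_\<rho>: "integrable M (\<lambda>\<omega>. \<rho> (t \<omega>))"
  proof (rule Bochner_Integration.integrable_bound)
    show "integrable M (\<lambda>\<omega>. K1 + K2 * (1 + norm (t \<omega>) powr q))"
      using moment by simp
    have "\<bar>\<rho> x\<bar> \<le> K1 + K2 * (1 + norm x powr q)" for x
      using growth[of x] mult_left_mono[OF power_le[of x] \<open>K2 \<ge> 0\<close>] by linarith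
    then show "AE \<omega> in M. norm (\<rho> (t \<omega>)) \<le> norm (K1 + K2 * (1 + norm (t \<omega>) powr q))"
      by (intro AE_I2) (metis abs_ge_self order_trans real_norm_def)
  qed measurable
  obtain G where "\<And>x. \<bar>g x\<bar> \<le> G"
    using g_bound unfolding bounded_iff by auto
  then have int_g: "integrable M (\<lambda>\<omega>. g (t \<omega>))"
    by (intro integrable_const_bound[where B = G]) auto
  have err: "\<bar>\<rho> x - g x\<bar> \<le> \<epsilon> + 2 * (K1 + K2) * L powr (real p - q) * norm x powr q" for x
  proof (cases "norm x \<le> L")
    case True
    have "0 \<le> 2 * (K1 + K2) * L powr (real p - q) * norm x powr q"
      using \<open>K1 \<ge> 0\<close> \<open>K2 \<ge> 0\<close> by simp
    with inside[OF True] show ?thesis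
      by linarith
  next
    case False
    then have x: "norm x > L" "norm x > 1"
      using \<open>L \<ge> 1\<close> by auto
    have "K1 * 1 \<le> K1 * norm x ^ p"
      using x \<open>K1 \<ge> 0\<close> by (intro mult_left_mono one_le_power) auto
    then have "\<bar>\<rho> x - g x\<bar> \<le> \<epsilon> + 2 * (K1 + K2) * norm x ^ p"
      using outside[OF x(1)] by (simp add: algebra_simps)
    also have "norm x ^ p = norm x powr (real p - q) * norm x powr q"
    proof -
      have "0 < norm x"
        using x(2) by linarith
      then show ?thesis
        by (simp add: powr_realpow flip: powr_add)
    qed
    also have "2 * (K1 + K2) * (norm x powr (real p - q) * norm x powr q) \<le>
        2 * (K1 + K2) * (L powr (real p - q) * norm x powr q)"
      using x \<open>L \<ge> 1\<close> \<open>K1 \<ge> 0\<close> \<open>K2 \<ge> 0\<close> \<open>real p \<le> q\<close>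
      by (intro mult_left_mono mult_right_mono powr_mono2') auto
    finally show ?thesis
      by (simp add: mult_ac)
  qed
  have "\<bar>(\<integral>\<omega>. \<rho> (t \<omega>) \<partial>M) - (\<integral>\<omega>. g (t \<omega>) \<partial>M)\<bar> = \<bar>\<integral>\<omega>. \<rho> (t \<omega>) - g (t \<omega>) \<partial>M\<bar>"
    using int_\<rho> int_g by simp
  also have "\<dots> \<le> (\<integral>\<omega>. \<bar>\<rho> (t \<omega>) - g (t \<omega>)\<bar> \<partial>M)"
    by (rule integral_abs_bound)
  also have "\<dots> \<le> (\<integral>\<omega>. \<epsilon> + 2 * (K1 + K2) * L powr (real p - q) * norm (t \<omega>) powr q \<partial>M)"
    using int_\<rho> int_g moment err by (intro integral_mono) auto
  also have "\<dots> = \<epsilon> + 2 * (K1 + K2) * L powr (real p - q) * (\<integral>\<omega>. norm (t \<omega>) powr q \<partial>M)"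
    using moment by (simp add: prob_space)
  finally show "\<bar>(\<integral>\<omega>. \<rho> (t \<omega>) \<partial>M) - (\<integral>\<omega>. g (t \<omega>) \<partial>M)\<bar>
      \<le> \<epsilon> + 2 * (K1 + K2) * L powr (real p - q) * (\<integral>\<omega>. norm (t \<omega>) powr q \<partial>M)" .
qed

text \<open>Without integrability the integral is 0 by convention, so the bound also covers test
  functions composed with a map of unknown measurability.\<close>

lemma (in prob_space) abs_integral_le_1:
  fixes f :: "'a \<Rightarrow> real"
  assumes "\<And>x. \<bar>f x\<bar> \<le> 1"
  shows "\<bar>\<integral>x. f x \<partial>M\<bar> \<le> 1"
proof (cases "integrable M f")
  case True
  have "\<bar>\<integral>x. f x \<partial>M\<bar> \<le> (\<integral>x. \<bar>f x\<bar> \<partial>M)"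
    by (rule integral_abs_bound)
  also have "\<dots> \<le> (\<integral>x. 1 \<partial>M)"
    using True assms by (intro integral_mono) auto
  finally show ?thesis
    by (simp add: prob_space)
qed (simp add: not_integrable_integral_eq)

text \<open>Dividing \<open>g\<close> by \<open>N + B + 1\<close> puts it into
  \<open>bounded_Lipschitz_1\<close>. The summand 1 keeps the divisor positive when \<open>g\<close>
  vanishes and \<open>N = 0\<close>.\<close>

lemma Lipschitz_integral_diff_le:
  fixes g :: "'t::real_normed_vector \<Rightarrow> real"
  assumes "prob_space M" "prob_space \<mu>" and g: "N-lipschitz_on UNIV g" "\<And>x. \<bar>g x\<bar> \<le> B"
  shows "\<bar>(\<integral>w. g (t w) \<partial>M) - (\<integral>x. g x \<partial>\<mu>)\<bar> \<le> (N + B + 1) *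
    (SUP f\<in>bounded_Lipschitz_1. \<bar>(\<integral>w. f (t w) \<partial>M) - (\<integral>x. f x \<partial>\<mu>)\<bar>)"
proof -
  interpret M: prob_space M by fact
  interpret \<mu>: prob_space \<mu> by fact
  define k where "k = N + B + 1"
  have N: "0 \<le> N" and B: "0 \<le> B"
    using lipschitz_on_nonneg[OF g(1)] g(2)[of 0] by auto
  then have k: "k > 0" "N \<le> k" "B \<le> k"
    by (auto simp: k_def)
  have "(\<lambda>x. g x / k) \<in> bounded_Lipschitz_1"
  proof -
    have "\<bar>g x / k\<bar> \<le> 1" for x
      using g(2)[of x] k by (simp add: abs_divide)
    moreover have "1-lipschitz_on UNIV (\<lambda>x. g x / k)"
    proof (rule lipschitz_onI)
      fix x y
      have "dist (g x) (g y) \<le> N * dist x y"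
        using lipschitz_onD[OF g(1)] by simp
      also have "\<dots> \<le> k * dist x y"
        using k by (intro mult_right_mono) auto
      finally show "dist (g x / k) (g y / k) \<le> 1 * dist x y"
        using k by (simp add: dist_real_def divide_le_eq mult.commute flip: diff_divide_distrib)
    qed simp
    ultimately show ?thesis
      by (simp add: bounded_Lipschitz_1_def)
  qed
  \<comment> \<open>A real supremum is an upper bound only for a set that is bounded above, which
    the bound 2 guarantees.\<close>
  moreover have "bdd_above ((\<lambda>f. \<bar>(\<integral>w. f (t w) \<partial>M) - (\<integral>x. f x \<partial>\<mu>)\<bar>) ` bounded_Lipschitz_1)"
  proof (rule bdd_aboveI2[where M = 2])
    fix f :: "'t \<Rightarrow> real"
    assume "f \<in> bounded_Lipschitz_1"
    then have "\<bar>\<integral>w. f (t w) \<partial>M\<bar> \<le> 1" "\<bar>\<integral>x. f x \<partial>\<mu>\<bar> \<le> 1"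
      by (auto simp: bounded_Lipschitz_1_def intro: M.abs_integral_le_1 \<mu>.abs_integral_le_1)
    then show "\<bar>(\<integral>w. f (t w) \<partial>M) - (\<integral>x. f x \<partial>\<mu>)\<bar> \<le> 2"
      by linarith
  qed
  ultimately have "\<bar>(\<integral>w. g (t w) / k \<partial>M) - (\<integral>x. g x / k \<partial>\<mu>)\<bar> \<le>
      (SUP f\<in>bounded_Lipschitz_1. \<bar>(\<integral>w. f (t w) \<partial>M) - (\<integral>x. f x \<partial>\<mu>)\<bar>)"
    by (rule cSUP_upper)
  then show ?thesis
    using k unfolding k_def[symmetric]
    by (simp add: abs_divide divide_le_eq mult.commute flip: diff_divide_distrib)
qed

text \<open>By Tonelli the joint \<open>q\<close>-th moment is the mean of the conditional one, so
  with high probability the latter is at most a constant independent of \<open>n\<close>. There the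
  truncation radius, and with it the Lipschitz approximant, can be fixed before \<open>n\<close>
  grows.\<close>

lemma cond_weak_conv_integral:
  fixes T :: "nat \<Rightarrow> 'a \<Rightarrow> 'w \<Rightarrow> 't::euclidean_space" and \<rho> :: "'t \<Rightarrow> real"
  assumes "prob_space MX" "prob_space MW" "prob_space \<mu>"
    and sets_\<mu>[measurable_cong]: "sets \<mu> = sets borel"
    and T_meas: "\<And>n. n > 0 \<Longrightarrow> case_prod (T n) \<in> borel_measurable (MX \<Otimes>\<^sub>M MW)"
    and moment: "\<And>n. n > 0 \<Longrightarrow>
      (\<integral>\<^sup>+z. ennreal (norm (T n (fst z) (snd z)) powr q) \<partial>(MX \<Otimes>\<^sub>M MW)) \<le> ennreal B"
    and \<mu>_moment: "integrable \<mu> (\<lambda>x. norm x ^ Suc p)"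
    and weak: "cond_weak_conv MX MW T \<mu>"
    and "real p < q" and cont: "continuous_on UNIV \<rho>"
    and K: "K1 \<ge> 0" "K2 \<ge> 0" and growth: "\<And>x. \<bar>\<rho> x\<bar> \<le> K1 + K2 * norm x ^ p"
  shows "n > 0 \<Longrightarrow> AE \<omega> in MX. integrable MW (\<lambda>w. \<rho> (T n \<omega> w))"
    and "integrable \<mu> \<rho>"
    and "conv_in_prob MX (\<lambda>n \<omega>. \<integral>w. \<rho> (T n \<omega> w) \<partial>MW) (\<integral>x. \<rho> x \<partial>\<mu>)"
proof -
  interpret MX: prob_space MX by fact
  interpret MW: prob_space MW by fact
  interpret \<mu>: prob_space \<mu> by fact
  have \<rho>_meas: "\<rho> \<in> borel_measurable borel"
    using cont by (rule borel_measurable_continuous_onI)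
  define I where "I n \<omega> = (\<integral>\<^sup>+w. ennreal (norm (T n \<omega> w) powr q) \<partial>MW)" for n \<omega>
  have norm_meas: "(\<lambda>z. ennreal (norm (T n (fst z) (snd z)) powr q)) \<in> borel_measurable (MX \<Otimes>\<^sub>M MW)"
    if "n > 0" for n
  proof -
    have "(\<lambda>z. T n (fst z) (snd z)) \<in> borel_measurable (MX \<Otimes>\<^sub>M MW)"
      using T_meas[OF that] by (simp add: case_prod_beta')
    then show ?thesis
      by measurable
  qed
  have I_meas: "I n \<in> borel_measurable MX" if "n > 0" for n
    using MW.borel_measurable_nn_integral_fst[OF norm_meas[OF that]] by (simp add: I_def[abs_def])
  have I_le: "(\<integral>\<^sup>+\<omega>. I n \<omega> \<partial>MX) \<le> ennreal B" if "n > 0" for n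
    using moment[OF that] MW.nn_integral_fst[OF norm_meas[OF that]] by (simp add: I_def)
  have T_sec: "T n \<omega> \<in> borel_measurable MW" if "n > 0" "\<omega> \<in> space MX" for n \<omega>
    using measurable_compose[OF measurable_Pair1'[OF that(2)] T_meas[OF that(1)]] by simp
  have I_int: "integrable MW (\<lambda>w. norm (T n \<omega> w) powr q)"
    if "n > 0" "\<omega> \<in> space MX" "I n \<omega> < \<top>" for n \<omega>
    using that T_sec[OF that(1,2)] by (intro integrableI_bounded) (auto simp: I_def)
  have \<mu>_int: "integrable \<mu> (\<lambda>x. norm x powr (real (Suc p)))"
    using \<mu>_moment by (simp add: powr_realpow' del: power_Suc of_nat_Suc)
  have g_meas: "g \<in> borel_measurable borel" if "N-lipschitz_on UNIV g" for N and g :: "'t \<Rightarrow> real"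
    using that by (intro borel_measurable_continuous_onI lipschitz_on_continuous_on)
  have approx: "\<exists>N g. N-lipschitz_on UNIV g \<and> bounded (range g) \<and>
      (\<forall>x. norm x \<le> L \<longrightarrow> \<bar>\<rho> x - g x\<bar> \<le> \<epsilon>) \<and>
      (\<forall>x. norm x > L \<longrightarrow> \<bar>\<rho> x - g x\<bar> \<le> \<epsilon> + 2 * (K1 + K2 * norm x ^ p))"
    if "L \<ge> 1" "\<epsilon> > 0" for L \<epsilon>
  proof -
    have "0 \<le> L"
      using that by simp
    from continuous_Lipschitz_approx_on_ball[OF cont this \<open>\<epsilon> > 0\<close> growth K(2)]
    show ?thesis
      by metis
  qed

  \<comment> \<open>A crude approximant at radius 1 with error 1 suffices for the two integrability
    claims; the convergence proof makes its own choice.\<close>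
  obtain N1 g1 where g1: "N1-lipschitz_on UNIV g1" "bounded (range g1)"
      "\<And>x. norm x \<le> 1 \<Longrightarrow> \<bar>\<rho> x - g1 x\<bar> \<le> 1"
      "\<And>x. norm x > 1 \<Longrightarrow> \<bar>\<rho> x - g1 x\<bar> \<le> 1 + 2 * (K1 + K2 * norm x ^ p)"
    using approx[of 1 1] by auto
  show "integrable \<mu> \<rho>"
    using truncation_error(1)[where L = 1 and \<epsilon> = 1, OF \<open>prob_space \<mu>\<close> _ \<rho>_meas g_meas[OF g1(1)] K growth g1(2) _ _ g1(3,4)
        _ \<mu>_int] by simp
  show "AE \<omega> in MX. integrable MW (\<lambda>w. \<rho> (T n \<omega> w))" if "n > 0"
  proof -
    have "AE \<omega> in MX. I n \<omega> \<noteq> \<infinity>"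
      using I_le[OF that] by (intro nn_integral_PInf_AE I_meas that) (auto simp: top_unique)
    then show ?thesis
      using AE_space
    proof eventually_elim
      case (elim \<omega>)
      then have "I n \<omega> < \<top>"
        by (simp add: less_top)
      from truncation_error(1)[where L = 1 and \<epsilon> = 1, OF \<open>prob_space MW\<close> T_sec[OF that elim(2)] \<rho>_meas g_meas[OF g1(1)] K
          growth g1(2) _ _ g1(3,4) _ I_int[OF that elim(2) this]]
      show ?case
        using \<open>real p < q\<close> by simp
    qed
  qed

  show "conv_in_prob MX (\<lambda>n \<omega>. \<integral>w. \<rho> (T n \<omega> w) \<partial>MW) (\<integral>x. \<rho> x \<partial>\<mu>)"
    unfolding conv_in_prob_def
  proof (intro allI impI order_tendstoI)
    fix \<epsilon> :: real and a :: ennreal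
    assume \<epsilon>: "\<epsilon> > 0" and "0 < a"
    \<comment> \<open>The bound \<open>a\<close> is an extended real and may be infinite; a finite
      positive \<open>\<tau>\<close> below it can be split into halves.\<close>
    obtain \<tau> where \<tau>: "\<tau> > 0" "ennreal \<tau> < a"
    proof (cases "a = \<top>")
      case True
      then show ?thesis
        by (intro that[of 1]) auto
    next
      case False
      then have "a = ennreal (enn2real a)" "enn2real a > 0"
        using \<open>0 < a\<close> by (auto simp: less_top enn2real_positive_iff)
      then show ?thesis
        by (intro that[of "enn2real a / 2"]) (metis ennreal_less_iff field_sum_of_halves half_gt_zero less_add_same_cancel1 order_less_imp_le)+
    qed
    \<comment> \<open>Chosen so that Markov's inequality gives
      \<open>(\<bar>B\<bar> + 1) / i0 = \<tau> / 2\<close>. Replacing \<open>B\<close> by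
      \<open>\<bar>B\<bar> + 1\<close> makes \<open>i0\<close> positive whatever the sign of
      \<open>B\<close>.\<close>
    define i0 where "i0 = 2 * (\<bar>B\<bar> + 1) / \<tau>"
    have i0: "i0 > 0"
      using \<tau> by (simp add: i0_def)
    define J where "J = (\<integral>x. norm x powr (real (Suc p)) \<partial>\<mu>)"
    have tail: "((\<lambda>L. 2 * (K1 + K2) * L powr s * b) \<longlongrightarrow> 0) at_top" if "s < 0" for s b :: real
      using tendsto_mult_right[OF tendsto_mult_left[OF tendsto_neg_powr[OF that filterlim_ident]],
          of "2 * (K1 + K2)" b] by simp
    \<comment> \<open>The error budget is \<open>\<epsilon> / 4\<close> each for truncation under
      the conditional law, truncation under the limit law and the Lipschitz comparison. The first
      two split into \<open>\<epsilon> / 8\<close> inside the ball and \<open>\<epsilon> / 8\<close>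
      for the tail.\<close>
    have "\<forall>\<^sub>F L in at_top. 2 * (K1 + K2) * L powr (real p - q) * i0 < \<epsilon> / 8 \<and>
        2 * (K1 + K2) * L powr (real p - real (Suc p)) * J < \<epsilon> / 8 \<and> L \<ge> 1"
      using \<open>real p < q\<close> \<epsilon> by (intro eventually_conj order_tendstoD(2)[OF tail] eventually_ge_at_top) auto
    then obtain L where L: "2 * (K1 + K2) * L powr (real p - q) * i0 < \<epsilon> / 8"
        "2 * (K1 + K2) * L powr (real p - real (Suc p)) * J < \<epsilon> / 8" "L \<ge> 1"
      using eventually_happens'[OF trivial_limit_at_top_linorder] by blast
    obtain N g where g: "N-lipschitz_on UNIV g" "bounded (range g)"
        "\<And>x. norm x \<le> L \<Longrightarrow> \<bar>\<rho> x - g x\<bar> \<le> \<epsilon> / 8"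
        "\<And>x. norm x > L \<Longrightarrow> \<bar>\<rho> x - g x\<bar> \<le> \<epsilon> / 8 + 2 * (K1 + K2 * norm x ^ p)"
      using approx[of L "\<epsilon> / 8"] L \<epsilon> by auto
    obtain G where G: "\<And>x. \<bar>g x\<bar> \<le> G"
      using g(2) unfolding bounded_iff by auto
    define k where "k = N + G + 1"
    have k: "k > 0"
      using lipschitz_on_nonneg[OF g(1)] G[of 0] by (simp add: k_def)
    have \<mu>_err: "\<bar>(\<integral>x. \<rho> x \<partial>\<mu>) - (\<integral>x. g x \<partial>\<mu>)\<bar> \<le> \<epsilon> / 8 + \<epsilon> / 8"
      using truncation_error(2)[OF \<open>prob_space \<mu>\<close> _ \<rho>_meas g_meas[OF g(1)] K growth g(2) L(3) _ g(3,4)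
          _ \<mu>_int] \<epsilon> L(2) by (simp add: J_def)
    define D where "D n \<omega> =
      (SUP f\<in>bounded_Lipschitz_1. \<bar>(\<integral>w. f (T n \<omega> w) \<partial>MW) - (\<integral>x. f x \<partial>\<mu>)\<bar>)" for n \<omega>
    \<comment> \<open>The threshold is divided by the rescaling constant \<open>k\<close> of
      \<open>g\<close>, so that off these events the Lipschitz comparison costs at most
      \<open>\<epsilon> / 4\<close>.\<close>
    have "(\<lambda>n. outer_measure_of MX {\<omega>\<in>space MX. \<bar>D n \<omega> - 0\<bar> > \<epsilon> / (4 * k)}) \<longlonglongrightarrow> 0"
      using weak k \<epsilon> unfolding cond_weak_conv_def conv_in_prob_def D_def by simp
    then have ev: "\<forall>\<^sub>F n in sequentially.
        outer_measure_of MX {\<omega>\<in>space MX. \<bar>D n \<omega> - 0\<bar> > \<epsilon> / (4 * k)} < ennreal (\<tau> / 2)"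
      by (rule order_tendstoD) (use \<tau> in simp)
    show "\<forall>\<^sub>F n in sequentially.
        outer_measure_of MX {\<omega>\<in>space MX. \<bar>(\<integral>w. \<rho> (T n \<omega> w) \<partial>MW) - (\<integral>x. \<rho> x \<partial>\<mu>)\<bar> > \<epsilon>} < a"
      using ev eventually_gt_at_top[of 0]
    proof eventually_elim
      case (elim n)
      \<comment> \<open>The inequality has the shape of Markov's inequality for extended reals. It
        also holds where \<open>I n \<omega>\<close> is infinite, so off \<open>?A\<close> the
        conditional \<open>q\<close>-th moment is finite and at most \<open>i0\<close>.\<close>
      let ?A = "{\<omega>\<in>space MX. 1 \<le> ennreal (1 / i0) * I n \<omega>}"
      let ?D = "{\<omega>\<in>space MX. \<bar>D n \<omega> - 0\<bar> > \<epsilon> / (4 * k)}"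
      have sub: "{\<omega>\<in>space MX. \<bar>(\<integral>w. \<rho> (T n \<omega> w) \<partial>MW) - (\<integral>x. \<rho> x \<partial>\<mu>)\<bar> > \<epsilon>} \<subseteq> ?A \<union> ?D"
      proof (rule subsetI, rule ccontr)
        fix \<omega>
        assume \<omega>: "\<omega> \<in> {\<omega>\<in>space MX. \<bar>(\<integral>w. \<rho> (T n \<omega> w) \<partial>MW) - (\<integral>x. \<rho> x \<partial>\<mu>)\<bar> > \<epsilon>}" "\<omega> \<notin> ?A \<union> ?D"
        then have sp: "\<omega> \<in> space MX" and small: "ennreal (1 / i0) * I n \<omega> < 1"
          and D: "\<bar>D n \<omega>\<bar> \<le> \<epsilon> / (4 * k)"
          by (auto simp: not_le)
        have fin: "I n \<omega> < \<top>"
          using small i0 by (auto simp: less_top[symmetric] ennreal_mult_top)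
        note int = I_int[OF elim(2) sp fin]
        define j where "j = (\<integral>w. norm (T n \<omega> w) powr q \<partial>MW)"
        have "0 \<le> j"
          unfolding j_def by (rule Bochner_Integration.integral_nonneg) simp
        have "I n \<omega> = ennreal j"
          unfolding I_def j_def using int by (rule nn_integral_eq_integral) simp
        moreover have "ennreal (1 / i0) * ennreal j = ennreal (1 / i0 * j)"
          using i0 \<open>0 \<le> j\<close> by (intro ennreal_mult[symmetric]) auto
        ultimately have "ennreal (1 / i0 * j) < ennreal 1"
          using small by simp
        then have "j \<le> i0"
          using i0 \<open>0 \<le> j\<close> by (simp add: ennreal_less_iff)
        have "\<bar>(\<integral>w. \<rho> (T n \<omega> w) \<partial>MW) - (\<integral>w. g (T n \<omega> w) \<partial>MW)\<bar> \<le>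
            \<epsilon> / 8 + 2 * (K1 + K2) * L powr (real p - q) * j"
          unfolding j_def using \<open>real p < q\<close> \<epsilon>
          by (intro truncation_error(2)[OF \<open>prob_space MW\<close> T_sec[OF elim(2) sp] \<rho>_meas g_meas[OF g(1)] K
                growth g(2) L(3) _ g(3,4) _ int]) auto
        also have "2 * (K1 + K2) * L powr (real p - q) * j \<le> 2 * (K1 + K2) * L powr (real p - q) * i0"
          using \<open>j \<le> i0\<close> K by (intro mult_left_mono) auto
        finally have W_err: "\<bar>(\<integral>w. \<rho> (T n \<omega> w) \<partial>MW) - (\<integral>w. g (T n \<omega> w) \<partial>MW)\<bar> \<le> \<epsilon> / 8 + \<epsilon> / 8"
          using L(1) by linarith
        have "\<bar>(\<integral>w. g (T n \<omega> w) \<partial>MW) - (\<integral>x. g x \<partial>\<mu>)\<bar> \<le> k * D n \<omega>"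
          unfolding k_def D_def by (rule Lipschitz_integral_diff_le) (fact assms g G)+
        also have "\<dots> \<le> k * (\<epsilon> / (4 * k))"
          using D k by (intro mult_left_mono) auto
        also have "\<dots> = \<epsilon> / 4"
          using k by simp
        finally have g_err: "\<bar>(\<integral>w. g (T n \<omega> w) \<partial>MW) - (\<integral>x. g x \<partial>\<mu>)\<bar> \<le> \<epsilon> / 4" .
        have "\<epsilon> < \<bar>(\<integral>w. \<rho> (T n \<omega> w) \<partial>MW) - (\<integral>x. \<rho> x \<partial>\<mu>)\<bar>"
          using \<omega>(1) by simp
        also have "\<dots> \<le> \<bar>(\<integral>w. \<rho> (T n \<omega> w) \<partial>MW) - (\<integral>w. g (T n \<omega> w) \<partial>MW)\<bar> +
            \<bar>(\<integral>w. g (T n \<omega> w) \<partial>MW) - (\<integral>x. g x \<partial>\<mu>)\<bar> + \<bar>(\<integral>x. \<rho> x \<partial>\<mu>) - (\<integral>x. g x \<partial>\<mu>)\<bar>"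
          by linarith
        finally show False
          using g_err \<mu>_err W_err \<epsilon> by linarith
      qed
      have A: "outer_measure_of MX ?A \<le> ennreal (\<tau> / 2)"
      proof -
        have [measurable]: "I n \<in> borel_measurable MX"
          by (rule I_meas) fact
        have "outer_measure_of MX ?A = emeasure MX ?A"
          by (intro outer_measure_of_eq) measurable
        also have "\<dots> \<le> ennreal (1 / i0) * (\<integral>\<^sup>+\<omega>. I n \<omega> * indicator (space MX) \<omega> \<partial>MX)"
          by (rule nn_integral_Markov_inequality) auto
        also have "(\<integral>\<^sup>+\<omega>. I n \<omega> * indicator (space MX) \<omega> \<partial>MX) = (\<integral>\<^sup>+\<omega>. I n \<omega> \<partial>MX)"
          by (intro nn_integral_cong) auto
        also have "ennreal (1 / i0) * \<dots> \<le> ennreal (1 / i0) * ennreal (\<bar>B\<bar> + 1)"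
          using I_le[OF elim(2)] by (intro mult_left_mono order_trans[OF I_le[OF elim(2)]] ennreal_leI) auto
        also have "\<dots> = ennreal (1 / i0 * (\<bar>B\<bar> + 1))"
          using i0 by (intro ennreal_mult[symmetric]) auto
        also have "1 / i0 * (\<bar>B\<bar> + 1) = \<tau> / 2"
        proof -
          have "1 / (2 * x / \<tau>) * x = \<tau> / 2" if "x \<noteq> 0" for x
            using that by simp
          from this[of "\<bar>B\<bar> + 1"] show ?thesis
            unfolding i0_def by linarith
        qed
        finally show ?thesis .
      qed
      have "outer_measure_of MX {\<omega>\<in>space MX. \<bar>(\<integral>w. \<rho> (T n \<omega> w) \<partial>MW) - (\<integral>x. \<rho> x \<partial>\<mu>)\<bar> > \<epsilon>}
          \<le> outer_measure_of MX ?A + outer_measure_of MX ?D"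
        using outer_measure_of_mono[OF sub] outer_measure_of_Un_le by (rule order_trans)
      also have "\<dots> \<le> ennreal (\<tau> / 2) + ennreal (\<tau> / 2)"
        using A elim(1) by (intro add_mono) auto
      also have "\<dots> = ennreal \<tau>"
        using \<tau> by (simp add: ennreal_plus[symmetric] del: ennreal_plus)
      also have "\<dots> < a"
        by fact
      finally show ?case .
    qed
  qed simp
qed

section \<open>Application to the bootstrap root\<close>

theorem theorem1:
  fixes MX :: "'a measure" and MW :: "'w measure" and P :: "'x measure"
    and X :: "nat \<Rightarrow> 'a \<Rightarrow> 'x" and W :: "nat \<Rightarrow> nat \<Rightarrow> 'w \<Rightarrow> real"
    and \<Theta> :: "(real^'d) set" and H :: "'h set" and d :: "'h \<Rightarrow> 'h \<Rightarrow> real"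
    and m :: "real^'d \<Rightarrow> 'h \<Rightarrow> 'x \<Rightarrow> real"
    and \<theta>0 :: "real^'d" and \<eta>0 :: 'h
    and \<theta>hat :: "nat \<Rightarrow> (nat \<Rightarrow> 'x) \<Rightarrow> real^'d" and \<eta>hat :: "nat \<Rightarrow> (nat \<Rightarrow> 'x) \<Rightarrow> 'h"
    and \<theta>star :: "nat \<Rightarrow> (nat \<Rightarrow> 'x) \<times> (nat \<Rightarrow> real) \<Rightarrow> real^'d"
    and \<eta>star :: "nat \<Rightarrow> (nat \<Rightarrow> 'x) \<times> (nat \<Rightarrow> real) \<Rightarrow> 'h"
    and S :: "real^'d^'d" and c p' :: real and p :: nat and \<rho> :: "real^'d \<Rightarrow> real"
  assumes spaces: "prob_space MX" "prob_space MW" "prob_space P"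
    and iid: "prob_space.indep_vars MX (\<lambda>_. P) X UNIV" "\<And>i. distr MX P (X i) = P"
    and dist: "Metric_space H d"
    and obj: "\<And>\<theta> \<eta>. \<theta> \<in> \<Theta> \<Longrightarrow> \<eta> \<in> H \<Longrightarrow> integrable P (m \<theta> \<eta>)"
    and true_par: "is_arg_max (\<lambda>(\<theta>, \<eta>). \<integral>x. m \<theta> \<eta> x \<partial>P) (\<lambda>z. z \<in> \<Theta> \<times> H) (\<theta>0, \<eta>0)"
    and est_meas: "\<And>n. n > 0 \<Longrightarrow> \<theta>hat n \<in> borel_measurable (Pi\<^sub>M {..<n} (\<lambda>_. P))"
    and est: "\<And>n. n > 0 \<Longrightarrow> AE \<omega> in MX.
          is_arg_max (\<lambda>(\<theta>, \<eta>). emp_mean n (sample n X \<omega>) (m \<theta> \<eta>)) (\<lambda>z. z \<in> \<Theta> \<times> H)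
            (\<theta>hat n (sample n X \<omega>), \<eta>hat n (sample n X \<omega>))"
    and boot_meas: "\<And>n. n > 0 \<Longrightarrow>
          \<theta>star n \<in> borel_measurable (Pi\<^sub>M {..<n} (\<lambda>_. P) \<Otimes>\<^sub>M Pi\<^sub>M {..<n} (\<lambda>_. borel))"
    and boot: "\<And>n. n > 0 \<Longrightarrow> AE (\<omega>, w) in MX \<Otimes>\<^sub>M MW.
          is_arg_max (\<lambda>(\<theta>, \<eta>). boot_mean n (sample n (W n) w) (sample n X \<omega>) (m \<theta> \<eta>))
            (\<lambda>z. z \<in> \<Theta> \<times> H)
            (\<theta>star n (sample n X \<omega>, sample n (W n) w), \<eta>star n (sample n X \<omega>, sample n (W n) w))"
    and cov: "covariance_matrix S"
    and c_pos: "c > 0"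
    and weights: "bootstrap_weights MW W c"
    and M1: "\<exists>K>0. \<forall>\<theta>\<in>\<Theta>. \<forall>\<eta>\<in>H.
          (\<integral>x. m \<theta> \<eta> x - m \<theta>0 \<eta>0 x \<partial>P) \<le> - K * ((norm (\<theta> - \<theta>0))\<^sup>2 + (d \<eta> \<eta>0)\<^sup>2)"
    and p'_ge: "p' \<ge> 1"
    and M2: "\<exists>C>0. \<forall>\<delta>>0. \<forall>n>0.
          outer_Lp_norm MX p' (\<lambda>\<omega>. sup_norm_on (nbhd_class m \<Theta> H d \<theta>0 \<eta>0 \<delta>)
            (emp_process P n (sample n X \<omega>))) \<le> ennreal (C * \<delta>) \<and>
          outer_Lp_norm (MX \<Otimes>\<^sub>M MW) p' (\<lambda>(\<omega>, w). sup_norm_on (nbhd_class m \<Theta> H d \<theta>0 \<eta>0 \<delta>)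
            (boot_process n (sample n (W n) w) (sample n X \<omega>))) \<le> ennreal (C * \<delta>)"
    and M3: "bigO_in_prob MX (\<lambda>n \<omega>. d (\<eta>hat n (sample n X \<omega>)) \<eta>0) (\<lambda>n. 1 / sqrt (real n))"
      "bigO_in_prob (MX \<Otimes>\<^sub>M MW)
         (\<lambda>n (\<omega>, w). d (\<eta>star n (sample n X \<omega>, sample n (W n) w)) \<eta>0) (\<lambda>n. 1 / sqrt (real n))"
    and consistent: "cond_weak_conv MX MW (boot_root c W X \<theta>star \<theta>hat) (centred_normal S)"
    and p: "1 \<le> p" "real p < p'"
    and \<rho>_cont: "continuous_on UNIV \<rho>"
    and \<rho>_growth: "\<exists>K1>0. \<exists>K2>0. \<forall>x. \<bar>\<rho> x\<bar> \<le> K1 + K2 * norm x ^ p"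
  shows "(\<forall>n>0. AE \<omega> in MX. integrable MW (\<lambda>w. \<rho> (boot_root c W X \<theta>star \<theta>hat n \<omega> w))) \<and>
    integrable (centred_normal S) \<rho> \<and>
    conv_in_prob MX (\<lambda>n \<omega>. \<integral>w. \<rho> (boot_root c W X \<theta>star \<theta>hat n \<omega> w) \<partial>MW)
      (\<integral>t. \<rho> t \<partial>centred_normal S)"
proof -
  interpret MX: prob_space MX by (rule spaces)
  interpret MW: prob_space MW by (rule spaces)
  interpret XW: pair_prob_space MX MW ..
  \<comment> \<open>Any exponent strictly between \<open>p\<close> and \<open>p'\<close> would do:
    one strict inequality is spent on the tail, the other on the geometric series.\<close>
  define q where "q = (real p + p') / 2"
  have q: "0 \<le> q" "real p < q" "q < p'"
    using p by (auto simp: q_def)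
  obtain K where K: "K > 0" and
    M1_K: "\<And>\<theta> \<eta>. \<theta> \<in> \<Theta> \<Longrightarrow> \<eta> \<in> H \<Longrightarrow>
      (\<integral>x. m \<theta> \<eta> x - m \<theta>0 \<eta>0 x \<partial>P) \<le> - K * ((norm (\<theta> - \<theta>0))\<^sup>2 + (d \<eta> \<eta>0)\<^sup>2)"
    using M1 by blast
  obtain C where C: "C > 0" and
    M2_X: "\<And>\<delta> n. \<delta> > 0 \<Longrightarrow> n > 0 \<Longrightarrow>
      outer_Lp_norm MX p' (\<lambda>\<omega>. sup_norm_on (nbhd_class m \<Theta> H d \<theta>0 \<eta>0 \<delta>)
        (emp_process P n (sample n X \<omega>))) \<le> ennreal (C * \<delta>)" and
    M2_XW: "\<And>\<delta> n. \<delta> > 0 \<Longrightarrow> n > 0 \<Longrightarrow>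
      outer_Lp_norm (MX \<Otimes>\<^sub>M MW) p' (\<lambda>(\<omega>, w). sup_norm_on (nbhd_class m \<Theta> H d \<theta>0 \<eta>0 \<delta>)
        (boot_process n (sample n (W n) w) (sample n X \<omega>))) \<le> ennreal (C * \<delta>)"
    using M2 by blast
  obtain K1 K2 where K12: "K1 \<ge> 0" "K2 \<ge> 0" and growth: "\<And>x. \<bar>\<rho> x\<bar> \<le> K1 + K2 * norm x ^ p"
    using \<rho>_growth less_imp_le by metis
  have par: "\<theta>0 \<in> \<Theta>" "\<eta>0 \<in> H"
    using true_par by (auto simp: is_arg_max_def)
  have d_nonneg: "0 \<le> d \<eta> \<eta>0" for \<eta>
    using Metric_space.nonneg[OF dist] .
  \<comment> \<open>The constant of \<open>M_estimator_moment_bound\<close> with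
    \<open>2 * C\<close> for \<open>C\<close>, the loss from
    \<open>outer_Lp_norm_majorant\<close>.\<close>
  define B where "B = 1 + (16 * (2 * C) / K) powr p' / (1 - 2 powr (q - p'))"

  have U: "\<exists>Z\<in>borel_measurable MX. (\<integral>\<^sup>+\<omega>. Z \<omega> \<partial>MX) \<le> ennreal ((2 * C * \<delta>) powr p') \<and>
      (\<forall>\<omega>\<in>space MX. ennreal_powr (sup_norm_on (nbhd_class m \<Theta> H d \<theta>0 \<eta>0 \<delta>)
        (emp_process P n (sample n X \<omega>))) p' \<le> Z \<omega>)" if "\<delta> > 0" "n > 0" for \<delta> n
  proof -
    have "p' > 0" "C * \<delta> > 0"
      using p'_ge C that by auto
    from outer_Lp_norm_majorant[OF M2_X[OF that] this] show ?thesis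
      by (metis mult.assoc)
  qed
  have V: "\<exists>Z\<in>borel_measurable (MX \<Otimes>\<^sub>M MW).
      (\<integral>\<^sup>+z. Z z \<partial>(MX \<Otimes>\<^sub>M MW)) \<le> ennreal ((2 * C * \<delta>) powr p') \<and>
      (\<forall>z\<in>space (MX \<Otimes>\<^sub>M MW). ennreal_powr (sup_norm_on (nbhd_class m \<Theta> H d \<theta>0 \<eta>0 \<delta>)
        (boot_process n (sample n (W n) (snd z)) (sample n X (fst z)))) p' \<le> Z z)"
    if "\<delta> > 0" "n > 0" for \<delta> n
  proof -
    have "p' > 0" "C * \<delta> > 0"
      using p'_ge C that by auto
    from outer_Lp_norm_majorant[OF M2_XW[OF that, unfolded case_prod_beta'] this] show ?thesis
      by (metis mult.assoc)
  qed
  have nn_integral_data: "(\<integral>\<^sup>+z. f (fst z) \<partial>(MX \<Otimes>\<^sub>M MW)) = (\<integral>\<^sup>+\<omega>. f \<omega> \<partial>MX)"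
    if [measurable]: "f \<in> borel_measurable MX" for f
    using MW.nn_integral_fst[of "\<lambda>z. f (fst z)" MX] by (simp add: MW.emeasure_space_1)

  \<comment> \<open>With unit weights \<open>boot_mean\<close> is \<open>emp_mean\<close>, so the
    bootstrap process is 0 and has the majorant 0.\<close>
  have hat_bound: "(\<integral>\<^sup>+\<omega>. ennreal ((sqrt (real n) * norm (\<theta>hat n (sample n X \<omega>) - \<theta>0)) powr q) \<partial>MX) \<le> ennreal B"
    if n: "n > 0" for n
    unfolding B_def
  proof (rule M_estimator_moment_bound[where w = "\<lambda>_ _. 1" and x = "sample n X" and P = P and m = m
        and H = H and \<Theta> = \<Theta> and d = d and ?\<eta>0.0 = \<eta>0 and \<xi> = "\<lambda>\<omega>. \<eta>hat n (sample n X \<omega>)"])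
    show "AE \<omega> in MX. is_arg_max (\<lambda>(\<theta>, \<eta>). boot_mean n (\<lambda>_. 1) (sample n X \<omega>) (m \<theta> \<eta>))
      (\<lambda>z. z \<in> \<Theta> \<times> H) (\<theta>hat n (sample n X \<omega>), \<eta>hat n (sample n X \<omega>))"
      using est[OF n] by (simp add: emp_mean_def boot_mean_def)
    show "\<exists>Z\<in>borel_measurable MX. (\<integral>\<^sup>+\<omega>. Z \<omega> \<partial>MX) \<le> ennreal ((2 * C * \<delta>) powr p') \<and>
      (\<forall>\<omega>\<in>space MX. ennreal_powr (sup_norm_on (nbhd_class m \<Theta> H d \<theta>0 \<eta>0 \<delta>)
        (boot_process n (\<lambda>_. 1) (sample n X \<omega>))) p' \<le> Z \<omega>)" for \<delta>
    proof -
      have "sup_norm_on F (boot_process n (\<lambda>_. 1) x) = 0"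
        for F :: "('x \<Rightarrow> real) set" and x
        using SUP_bot[of F, where 'a = ennreal] unfolding bot_ennreal
        by (simp add: sup_norm_on_def boot_process_def boot_mean_def emp_mean_def)
      then show ?thesis
        by (intro bexI[of _ "\<lambda>_. 0"]) (auto simp: ennreal_powr_def)
    qed
  qed (use n K C q p'_ge par d_nonneg M1_K U spaces in auto)
  have star_bound: "(\<integral>\<^sup>+z. ennreal ((sqrt (real n) *
      norm (\<theta>star n (sample n X (fst z), sample n (W n) (snd z)) - \<theta>0)) powr q) \<partial>(MX \<Otimes>\<^sub>M MW)) \<le> ennreal B"
    if n: "n > 0" for n
    unfolding B_def
  proof (rule M_estimator_moment_bound[where w = "\<lambda>z. sample n (W n) (snd z)"
        and x = "\<lambda>z. sample n X (fst z)" and P = P and m = m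
        and H = H and \<Theta> = \<Theta> and d = d and ?\<eta>0.0 = \<eta>0
        and \<xi> = "\<lambda>z. \<eta>star n (sample n X (fst z), sample n (W n) (snd z))"])
    show "AE z in MX \<Otimes>\<^sub>M MW. is_arg_max
      (\<lambda>(\<theta>, \<eta>). boot_mean n (sample n (W n) (snd z)) (sample n X (fst z)) (m \<theta> \<eta>))
      (\<lambda>z. z \<in> \<Theta> \<times> H) (\<theta>star n (sample n X (fst z), sample n (W n) (snd z)),
        \<eta>star n (sample n X (fst z), sample n (W n) (snd z)))"
      using boot[OF n] by (simp add: case_prod_beta')
    \<comment> \<open>The majorant of the empirical process lives on the data space. It is lifted
      along the first projection, which preserves its integral since \<open>MW\<close> has mass
      1.\<close>
    show "\<exists>Z\<in>borel_measurable (MX \<Otimes>\<^sub>M MW).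
      (\<integral>\<^sup>+z. Z z \<partial>(MX \<Otimes>\<^sub>M MW)) \<le> ennreal ((2 * C * \<delta>) powr p') \<and>
      (\<forall>z\<in>space (MX \<Otimes>\<^sub>M MW). ennreal_powr (sup_norm_on (nbhd_class m \<Theta> H d \<theta>0 \<eta>0 \<delta>)
        (emp_process P n (sample n X (fst z)))) p' \<le> Z z)" if \<delta>: "\<delta> > 0" for \<delta>
    proof -
      obtain Z where [measurable]: "Z \<in> borel_measurable MX"
        and Z: "(\<integral>\<^sup>+\<omega>. Z \<omega> \<partial>MX) \<le> ennreal ((2 * C * \<delta>) powr p')"
          "\<And>\<omega>. \<omega> \<in> space MX \<Longrightarrow> ennreal_powr (sup_norm_on (nbhd_class m \<Theta> H d \<theta>0 \<eta>0 \<delta>)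
            (emp_process P n (sample n X \<omega>))) p' \<le> Z \<omega>"
        using U[OF \<delta> n] by blast
      then show ?thesis
        by (intro bexI[of _ "\<lambda>z. Z (fst z)"]) (auto simp: nn_integral_data space_pair_measure)
    qed
  qed (use n K C q p'_ge par d_nonneg M1_K V XW.prob_space_axioms in auto)

  have X_meas: "sample n X \<in> MX \<rightarrow>\<^sub>M Pi\<^sub>M {..<n} (\<lambda>_. P)" for n
    using iid(1) unfolding sample_def MX.indep_vars_def by (intro measurable_restrict) auto
  have W_meas: "sample n (W n) \<in> MW \<rightarrow>\<^sub>M Pi\<^sub>M {..<n} (\<lambda>_. borel)" for n
    using weights unfolding sample_def bootstrap_weights_def by (intro measurable_restrict) auto
  have hat_meas: "(\<lambda>\<omega>. \<theta>hat n (sample n X \<omega>)) \<in> borel_measurable MX" if "n > 0" for n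
    using measurable_compose[OF X_meas est_meas[OF that]] .
  have star_meas: "(\<lambda>z. \<theta>star n (sample n X (fst z), sample n (W n) (snd z))) \<in> borel_measurable (MX \<Otimes>\<^sub>M MW)"
    if "n > 0" for n
    by (rule measurable_compose[OF measurable_Pair boot_meas[OF that]])
      (rule measurable_compose[OF measurable_fst X_meas] measurable_compose[OF measurable_snd W_meas])+

  have root_meas: "case_prod (boot_root c W X \<theta>star \<theta>hat n) \<in> borel_measurable (MX \<Otimes>\<^sub>M MW)"
    if n: "n > 0" for n
  proof -
    note [measurable] = star_meas[OF n] measurable_compose[OF measurable_fst hat_meas[OF n]]
    show ?thesis
      unfolding boot_root_def case_prod_beta' by measurable
  qed
  have root_moment: "(\<integral>\<^sup>+z. ennreal (norm (boot_root c W X \<theta>star \<theta>hat n (fst z) (snd z)) powr q)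
      \<partial>(MX \<Otimes>\<^sub>M MW)) \<le> ennreal ((2 / c) powr q * (B + B))" if n: "n > 0" for n
  proof -
    note [measurable] = star_meas[OF n] hat_meas[OF n]
    define s where "s z = sqrt (real n) * norm (\<theta>star n (sample n X (fst z), sample n (W n) (snd z)) - \<theta>0)" for z
    define h where "h \<omega> = sqrt (real n) * norm (\<theta>hat n (sample n X \<omega>) - \<theta>0)" for \<omega>
    have [measurable]: "s \<in> borel_measurable (MX \<Otimes>\<^sub>M MW)" "h \<in> borel_measurable MX"
      unfolding s_def[abs_def] h_def[abs_def] by measurable
    have pt: "norm (boot_root c W X \<theta>star \<theta>hat n (fst z) (snd z)) powr q \<le>
        (2 / c) powr q * (s z powr q + h (fst z) powr q)" for z
    proof -
      \<comment> \<open>The maximum replaces a convexity inequality: the sum is at most twice the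
        maximum, and the \<open>q\<close>-th power of the maximum is one of the two powers. This is
        the origin of \<open>2 / c\<close>.\<close>
      define x where "x = max (s z) (h (fst z))"
      have x: "0 \<le> x"
        by (simp add: x_def s_def le_max_iff_disj)
      have "norm (boot_root c W X \<theta>star \<theta>hat n (fst z) (snd z)) =
          sqrt (real n) / c * norm ((\<theta>star n (sample n X (fst z), sample n (W n) (snd z)) - \<theta>0)
            - (\<theta>hat n (sample n X (fst z)) - \<theta>0))"
        using c_pos by (simp add: boot_root_def)
      also have "\<dots> \<le> sqrt (real n) / c * (norm (\<theta>star n (sample n X (fst z), sample n (W n) (snd z)) - \<theta>0)
            + norm (\<theta>hat n (sample n X (fst z)) - \<theta>0))"
        using c_pos by (intro mult_left_mono norm_triangle_ineq4) auto
      also have "\<dots> = (s z + h (fst z)) / c"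
        by (simp add: s_def h_def field_simps)
      also have "\<dots> \<le> (x + x) / c"
        using c_pos by (intro divide_right_mono add_mono) (auto simp: x_def)
      finally have "norm (boot_root c W X \<theta>star \<theta>hat n (fst z) (snd z)) \<le> 2 / c * x"
        by simp
      then have "norm (boot_root c W X \<theta>star \<theta>hat n (fst z) (snd z)) powr q \<le> (2 / c * x) powr q"
        using q by (intro powr_mono2) auto
      also have "\<dots> = (2 / c) powr q * x powr q"
        by (rule powr_mult)
      also have "x powr q \<le> s z powr q + h (fst z) powr q"
        by (simp add: x_def max_def)
      finally show ?thesis
        using c_pos by (simp add: mult_left_mono)
    qed
    have "B \<ge> 0"
      using q powr_mono[of "q - p'" 0 "2::real"] by (auto simp: B_def intro!: add_nonneg_nonneg divide_nonneg_nonneg)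
    have "(\<integral>\<^sup>+z. ennreal (norm (boot_root c W X \<theta>star \<theta>hat n (fst z) (snd z)) powr q) \<partial>(MX \<Otimes>\<^sub>M MW)) \<le>
        (\<integral>\<^sup>+z. ennreal ((2 / c) powr q) * (ennreal (s z powr q) + ennreal (h (fst z) powr q)) \<partial>(MX \<Otimes>\<^sub>M MW))"
      using pt by (intro nn_integral_mono) (simp add: ennreal_leI flip: ennreal_mult ennreal_plus)
    also have "\<dots> = ennreal ((2 / c) powr q) *
        ((\<integral>\<^sup>+z. ennreal (s z powr q) \<partial>(MX \<Otimes>\<^sub>M MW)) + (\<integral>\<^sup>+\<omega>. ennreal (h \<omega> powr q) \<partial>MX))"
      using nn_integral_data[of "\<lambda>\<omega>. ennreal (h \<omega> powr q)"] by (simp add: nn_integral_cmult nn_integral_add)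
    also have "\<dots> \<le> ennreal ((2 / c) powr q) * (ennreal B + ennreal B)"
      using star_bound[OF n] hat_bound[OF n] unfolding s_def h_def
      by (intro mult_left_mono add_mono) auto
    also have "\<dots> = ennreal ((2 / c) powr q * (B + B))"
      using \<open>B \<ge> 0\<close> by (simp only: ennreal_mult ennreal_plus powr_ge_zero add_nonneg_nonneg)
    finally show ?thesis .
  qed
  \<comment> \<open>The normal law has moments of every order; order \<open>Suc p\<close> is the one
    selected here.\<close>
  note conclusions = cond_weak_conv_integral[OF spaces(1,2) centred_normal_moments(1,2) root_meas root_moment
      centred_normal_moments(3) consistent q(2) \<rho>_cont K12 growth]
  show ?thesis
    using conclusions by blast
qed

end
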